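(* Let $\lambda=(\lambda_1,\dots,\lambda_n)\in\mathbb{C}^n$ with $\lambda_i\ne\lambda_j$ for $i\neq j$ and $|\lambda_i|=1$ for $i=1,\dots,n$, and let $A=\mathrm{diag}(\lambda_1,\dots,\lambda_n)$ be non-resonant. Let $(M_k)_{k\ge1}$ and $(N_k)_{k\ge1}$ be sequences of positive real numbers verifying hypotheses 0)--3) listed in the context. Let $\mathbf{F}\in V_0$ be of the form $\mathbf{F}(\mathbf{z})=A\mathbf{z}+\mathbf{f}(\mathbf{z})$ with $\mathbf{f}\in V_1$, and let $\mathbf{H}$ be its linearization. Then: (1) If moreover $\mathbf{F}\in\mathcal{C}_{(M_k)}\cap V_0$ and $A$ verifies the Bruno condition $$\sum_{k=0}^{+\infty}\frac{\log\tilde\Omega^{-1}(p_{k+1})}{p_k}<+\infty$$ for some increasing sequence of natural numbers $(p_k)_k$, then the linearization $\mathbf{H}$ also belongs to $\mathcal{C}_{(M_k)}\cap V_0$. (2) If $\mathbf{F}$ is a germ of analytic diffeomorphism of $(\mathbb{C}^n,0)$ and there exists an increasing sequence of integers $(p_k)_k$ such that $$\limsup_{|\alpha|\to+\infty}\left(2\sum_{m=0}^{\kappa(\alpha)}\frac{\log\Omega^{-1}(p_{m+1})}{p_m}-\frac1{|\alpha|}\log N_{|\alpha|}\right)<+\infty,$$ where $\kappa(\alpha)$ is the integer defined by $p_{\kappa(\alpha)}\le|\alpha|<p_{\kappa(\alpha)+1}$, then $\mathbf{H}\in\mathcal{C}_{(N_k)}\cap V_0$. (3) If $\mathbf{F}\in\mathcal{C}_{(M_k)}\cap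 V_0$, $(M_k)_k$ is asymptotically bounded by $(N_k)_k$ (namely $N_k\ge M_k$ for all sufficiently large $k$), and there exists an increasing sequence of integers $(p_k)_k$ such that $$\limsup_{|\alpha|\to+\infty}\left(2\sum_{m=0}^{\kappa(\alpha)}\frac{\log\Omega^{-1}(p_{m+1})}{p_m}-\frac1{|\alpha|}\log\frac{N_{|\alpha|}}{M_{|\alpha|}}\right)<+\infty,$$ where $\kappa(\alpha)$ is the integer defined by $p_{\kappa(\alpha)}\le|\alpha|<p_{\kappa(\alpha)+1}$, then $\mathbf{H}\in\mathcal{C}_{(N_k)}\cap V_0$.
   Context: For $\alpha\in\mathbb{N}^n$, $|\alpha|=\alpha_1+\dots+\alpha_n$, $z^\alpha=z_1^{\alpha_1}\cdots z_n^{\alpha_n}$, $\lambda^\alpha=\lambda_1^{\alpha_1}\cdots\lambda_n^{\alpha_n}$ (also for $\alpha\in\mathbb{Z}^n$); for $\alpha\in\mathbb{Z}^n$, $|\alpha|=\sum_i|\alpha_i|$. $V=\mathbb{C}^n[[z_1,\dots,z_n]]$ is the space of formal power series $\mathbf{f}=\sum_{\alpha\in\mathbb{N}^n}\mathbf{f}_\alpha z^\alpha$, $\mathbf{f}_\alpha\in\mathbb{C}^n$; $v(\mathbf{f})=\inf\{|\alpha|:\mathbf{f}_\alpha\ne0\}$ and $V_j=\{\mathbf{f}\in V:v(\mathbf{f})>j\}$. $A=\mathrm{diag}(\lambda_1,\dots,\lambda_n)$ is resonant if there exist $\alpha\in\mathbb{N}^n$ with $|\alpha|\ge2$ and $j\in\{1,\dots,n\}$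 such that $\lambda^\alpha-\lambda_j=0$; otherwise it is non-resonant. When $A$ is non-resonant, the linearization of $\mathbf{F}$ is the unique formal power series $\mathbf{H}(\mathbf{z})=\mathbf{z}+\mathbf{h}(\mathbf{z})$, $\mathbf{h}\in V_1$, such that $\mathbf{F}\circ\mathbf{H}(\mathbf{z})=\mathbf{H}(A\mathbf{z})$. Hypotheses on a sequence $(M_k)_{k\ge1}$ of positive reals: 0) $\inf_{k\ge1}M_k^{1/k}>0$; 1) there exists $C_1>0$ such that $M_{k+1}\le C_1^{k+1}M_k$ for all $k\ge1$; 2) $(M_k)_{k\ge1}$ is logarithmically convex; 3) $M_kM_l\le M_{k+l-1}$ for all $k,l\ge1$. The class $\mathcal{C}_{(M_k)}$ is the set of $\mathbf{f}=\sum\mathbf{f}_\alpha z^\alpha\in V$ for which there exist constants $A,B>0$ with $|\mathbf{f}_\alpha|\le AB^{|\alpha|}M_{|\alpha|}$ for all $\alpha\in\mathbb{N}^n$ with $|\alpha|\geq 1$. Small divisors: for $p\in\mathbb{N}$, $p\ge2$, $$\tilde\Omega(p)=\min_{1\le j\le n}\ \inf_{\alpha\in\mathbb{Z}^n,\ |\alpha|<p,\ \alpha\ne e_j}|\lambda^\alpha-\lambda_j|,$$ with $e_j$ the $j$-th canonical basis vector. Writing $\lambda_j=e^{2\pi i\omega_j}$ with $\omega_j\in(-1/2,1/2)\setminus\mathbb{Q}$ and $\omega=(\omega_1,\dots,\omega_n)$, $$\Omega(p)=\min\{\{\nu\cdot\omega\}:\nu\in\mathbb{Z}^n,\ 0<|\nu|\le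 p\},$$ where $\{x\}$ is the distance of $x$ from the nearest integer. The sequences $(p_k)_k$ are increasing sequences of positive integers; conditions involving $\Omega^{-1}$ or $\tilde\Omega^{-1}$ are regarded as not satisfied if the corresponding quantity $\Omega$ or $\tilde\Omega$ vanishes. *)

theory Defs
  imports "HOL-Analysis.Analysis"
begin

section \<open>Multi-indices\<close>

definition mdeg :: "nat ^ 'n::finite \<Rightarrow> nat" where
  "mdeg \<alpha> = (\<Sum>i\<in>UNIV. \<alpha> $ i)"

definition zdeg :: "int ^ 'n::finite \<Rightarrow> nat" where
  "zdeg \<nu> = (\<Sum>i\<in>UNIV. nat \<bar>\<nu> $ i\<bar>)"

definition mpow :: "complex ^ 'n::finite \<Rightarrow> nat ^ 'n \<Rightarrow> complex" where
  "mpow z \<alpha> = (\<Prod>i\<in>UNIV. z $ i ^ (\<alpha> $ i))"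

definition zpow :: "complex ^ 'n::finite \<Rightarrow> int ^ 'n \<Rightarrow> complex" where
  "zpow z \<nu> = (\<Prod>i\<in>UNIV. z $ i powi (\<nu> $ i))"

lemma mdeg_zero [simp]: "mdeg 0 = 0"
  by (simp add: mdeg_def)

lemma mdeg_add [simp]: "mdeg (\<alpha> + \<beta>) = mdeg \<alpha> + mdeg \<beta>"
  by (simp add: mdeg_def sum.distrib)

lemma mdeg_axis [simp]: "mdeg (axis j k) = k"
  by (simp add: mdeg_def axis_def if_distrib cong: if_cong)

lemma axis_nz [simp]: "axis j (Suc 0) \<noteq> (0 :: nat ^ 'n::finite)" "0 \<noteq> (axis j (Suc 0) :: nat ^ 'n::finite)"
  by (auto simp: vec_eq_iff axis_def)

lemma mdeg_eq_0_iff [simp]: "mdeg \<alpha> = 0 \<longleftrightarrow> \<alpha> = 0"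
  by (simp add: mdeg_def vec_eq_iff)

lemma mdeg_eq_1: 
  assumes "mdeg \<alpha> = 1" obtains j where "\<alpha> = axis j 1"
proof -
  obtain j where j: "\<alpha> $ j = 1" "\<forall>i\<in>UNIV. j \<noteq> i \<longrightarrow> \<alpha> $ i = 0"
    using assms unfolding mdeg_def by (metis finite_code sum_eq_1_iff)
  have "\<alpha> = axis j 1" using j by (auto simp: vec_eq_iff axis_def)
  then show ?thesis using that by blast
qed

lemma finite_mdeg_le [simp, intro]: "finite {\<alpha> :: nat ^ 'n::finite. mdeg \<alpha> \<le> d}"
proof -
  have "finite (vec_nth ` {\<alpha> :: nat ^ 'n. mdeg \<alpha> \<le> d})"
  proof (rule finite_subset)
    show "vec_nth ` {\<alpha> :: nat ^ 'n. mdeg \<alpha> \<le> d} \<subseteq> (\<Pi>\<^sub>E i\<in>UNIV. {..d})"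
      by (auto simp: mdeg_def) (meson finite_code iso_tuple_UNIV_I member_le_sum order_trans zero_le)
    show "finite (\<Pi>\<^sub>E i\<in>(UNIV::'n set). {..d})" by (intro finite_PiE) auto
  qed
  moreover have "inj_on vec_nth {\<alpha> :: nat ^ 'n. mdeg \<alpha> \<le> d}"
    by (auto simp: inj_on_def vec_nth_inject)
  ultimately show ?thesis using finite_imageD by blast
qed


section \<open>Scalar formal power series in finitely many variables\<close>

typedef (overloaded) 'n mfps = "UNIV :: (nat ^ 'n::finite \<Rightarrow> complex) set"
  morphisms mcoeff Abs_mfps ..

lemma mcoeff_Abs [simp]: "mcoeff (Abs_mfps f) = f"
  by (simp add: Abs_mfps_inverse)

lemma mfps_eq_iff: "f = g \<longleftrightarrow> (\<forall>\<alpha>. mcoeff f \<alpha> = mcoeff g \<alpha>)"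
  by (metis mcoeff_inject ext)

lemma mfps_eqI: "(\<And>\<alpha>. mcoeff f \<alpha> = mcoeff g \<alpha>) \<Longrightarrow> f = g"
  by (simp add: mfps_eq_iff)

definition msplits :: "nat ^ 'n::finite \<Rightarrow> ((nat ^ 'n) \<times> (nat ^ 'n)) set" where
  "msplits \<alpha> = {(\<beta>, \<gamma>). \<beta> + \<gamma> = \<alpha>}"

lemma finite_msplits [simp, intro]: "finite (msplits \<alpha>)"
proof (rule finite_subset)
  show "msplits \<alpha> \<subseteq> {\<beta>. mdeg \<beta> \<le> mdeg \<alpha>} \<times> {\<beta>. mdeg \<beta> \<le> mdeg \<alpha>}"
    by (auto simp: msplits_def)
qed auto

instantiation mfps :: (finite) comm_ring_1
begin

definition "0 = Abs_mfps (\<lambda>_. 0)"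
definition "1 = Abs_mfps (\<lambda>\<alpha>. if \<alpha> = 0 then 1 else 0)"
definition "f + g = Abs_mfps (\<lambda>\<alpha>. mcoeff f \<alpha> + mcoeff g \<alpha>)"
definition "f - g = Abs_mfps (\<lambda>\<alpha>. mcoeff f \<alpha> - mcoeff g \<alpha>)"
definition "- f = Abs_mfps (\<lambda>\<alpha>. - mcoeff f \<alpha>)"
definition "f * g = Abs_mfps (\<lambda>\<alpha>. \<Sum>(\<beta>, \<gamma>)\<in>msplits \<alpha>. mcoeff f \<beta> * mcoeff g \<gamma>)"

instance
proof
  fix f g h :: "'a mfps"
  show "f * g * h = f * (g * h)"
  proof (rule mfps_eqI)
    fix \<alpha>
    have "mcoeff (f * g * h) \<alpha> = (\<Sum>p\<in>msplits \<alpha>. \<Sum>q\<in>msplits (fst p). mcoeff f (fst q) * mcoeff g (snd q) * mcoeff h (snd p))"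
      by (simp add: times_mfps_def case_prod_unfold sum_distrib_right)
    also have "\<dots> = (\<Sum>(p,q)\<in>Sigma (msplits \<alpha>) (\<lambda>p. msplits (fst p)). mcoeff f (fst q) * mcoeff g (snd q) * mcoeff h (snd p))"
      by (rule sum.Sigma) auto
    also have "\<dots> = (\<Sum>(p,q)\<in>Sigma (msplits \<alpha>) (\<lambda>p. msplits (snd p)). mcoeff f (fst p) * (mcoeff g (fst q) * mcoeff h (snd q)))"
      by (rule sum.reindex_bij_witness[of _ "\<lambda>((a,b),(c,d)). ((a + c, d), (a, c))" "\<lambda>((a,b),(c,d)). ((c, d + b), (d, b))"])
        (auto simp: msplits_def algebra_simps)
    also have "\<dots> = (\<Sum>p\<in>msplits \<alpha>. \<Sum>q\<in>msplits (snd p). mcoeff f (fst p) * (mcoeff g (fst q) * mcoeff h (snd q)))"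
      by (rule sum.Sigma[symmetric]) auto
    also have "\<dots> = mcoeff (f * (g * h)) \<alpha>"
      by (simp add: times_mfps_def case_prod_unfold sum_distrib_left)
    finally show "mcoeff (f * g * h) \<alpha> = mcoeff (f * (g * h)) \<alpha>" .
  qed
  show "f * g = g * f"
  proof (rule mfps_eqI)
    fix \<alpha>
    show "mcoeff (f * g) \<alpha> = mcoeff (g * f) \<alpha>"
      unfolding times_mfps_def mcoeff_Abs
      by (rule sum.reindex_bij_witness[of _ prod.swap prod.swap]) (auto simp: msplits_def add.commute)
  qed
  show "1 * f = f"
  proof (rule mfps_eqI)
    fix \<alpha>
    have "mcoeff (1 * f) \<alpha> = (\<Sum>(\<beta>, \<gamma>)\<in>msplits \<alpha>. (if \<beta> = 0 then 1 else 0) * mcoeff f \<gamma>)"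
      by (simp add: times_mfps_def one_mfps_def)
    also have "\<dots> = (\<Sum>(\<beta>, \<gamma>)\<in>{(0 :: nat ^ 'a, \<alpha>)}. (if \<beta> = 0 then 1 else 0) * mcoeff f \<gamma>)"
      proof (rule sum.mono_neutral_right)
      show "finite (msplits \<alpha>)" by (rule finite_msplits)
    qed (auto simp: msplits_def split: if_splits)
    finally show "mcoeff (1 * f) \<alpha> = mcoeff f \<alpha>" by simp
  qed
  show "(f + g) * h = f * h + g * h"
    by (rule mfps_eqI) (simp add: times_mfps_def plus_mfps_def case_prod_unfold distrib_right sum.distrib)
  show "f + g + h = f + (g + h)" "f + g = g + f" "0 + f = f" "- f + f = 0" "f - g = f + - g"
    "(0::'a mfps) \<noteq> 1"
    by (auto simp: mfps_eq_iff plus_mfps_def zero_mfps_def uminus_mfps_def minus_mfps_def one_mfps_def)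
qed

end

lemma mcoeff_zero [simp]: "mcoeff 0 \<alpha> = 0"
  by (simp add: zero_mfps_def)

lemma mcoeff_one: "mcoeff 1 \<alpha> = (if \<alpha> = 0 then 1 else 0)"
  by (simp add: one_mfps_def)

lemma mcoeff_add [simp]: "mcoeff (f + g) \<alpha> = mcoeff f \<alpha> + mcoeff g \<alpha>"
  by (simp add: plus_mfps_def)

lemma mcoeff_diff [simp]: "mcoeff (f - g) \<alpha> = mcoeff f \<alpha> - mcoeff g \<alpha>"
  by (simp add: minus_mfps_def)

lemma mcoeff_mult:
  "mcoeff (f * g) \<alpha> = (\<Sum>(\<beta>, \<gamma>)\<in>msplits \<alpha>. mcoeff f \<beta> * mcoeff g \<gamma>)"
  by (simp add: times_mfps_def)


section \<open>The space V of vector valued formal power series\<close>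

type_synonym 'n vfps = "('n mfps, 'n) vec"

definition vcoeff :: "'n::finite vfps \<Rightarrow> nat ^ 'n \<Rightarrow> complex ^ 'n" where
  "vcoeff F \<alpha> = (\<chi> i. mcoeff (F $ i) \<alpha>)"

definition vval :: "'n::finite vfps \<Rightarrow> enat" where
  "vval F = (INF \<alpha>\<in>{\<alpha>. vcoeff F \<alpha> \<noteq> 0}. enat (mdeg \<alpha>))"

definition V :: "nat \<Rightarrow> 'n::finite vfps set" where
  "V j = {F. vval F > enat j}"

definition linear_series :: "complex ^ 'n ^ 'n \<Rightarrow> 'n::finite vfps" where
  "linear_series A = (\<chi> i. Abs_mfps (\<lambda>\<alpha>. \<Sum>j\<in>UNIV. if \<alpha> = axis j 1 then A $ i $ j else 0))"

abbreviation id_series :: "'n::finite vfps" where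
  "id_series \<equiv> linear_series (mat 1)"

text \<open>
  Substitution is only used for a series \<open>G\<close> without constant term.  Then \<open>G\<^sup>\<alpha>\<close> contains only
  terms of degree at least \<open>\<bar>\<alpha>\<bar>\<close>, so that the coefficient of \<open>z\<^sup>\<beta>\<close> in \<open>\<Sum>\<^sub>\<alpha> f\<^sub>\<alpha> G\<^sup>\<alpha>\<close> only
  receives contributions from the finitely many \<open>\<alpha>\<close> with \<open>\<bar>\<alpha>\<bar> \<le> \<bar>\<beta>\<bar>\<close>.
\<close>

definition mfps_compose :: "'n::finite mfps \<Rightarrow> 'n vfps \<Rightarrow> 'n mfps" where
  "mfps_compose f G =
     Abs_mfps (\<lambda>\<beta>. \<Sum>\<alpha> | mdeg \<alpha> \<le> mdeg \<beta>. mcoeff f \<alpha> * mcoeff (\<Prod>i\<in>UNIV. (G $ i) ^ (\<alpha> $ i)) \<beta>)"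

definition vfps_compose :: "'n::finite vfps \<Rightarrow> 'n vfps \<Rightarrow> 'n vfps" (infixl "\<circ>\<^sub>V" 55) where
  "F \<circ>\<^sub>V G = (\<chi> i. mfps_compose (F $ i) G)"


section \<open>Linearization\<close>

definition diag_matrix :: "complex ^ 'n \<Rightarrow> complex ^ 'n ^ 'n" where
  "diag_matrix lam = (\<chi> i j. if i = j then lam $ i else 0)"

definition resonant :: "complex ^ 'n::finite \<Rightarrow> bool" where
  "resonant lam \<longleftrightarrow> (\<exists>\<alpha> j. mdeg \<alpha> \<ge> 2 \<and> mpow lam \<alpha> - lam $ j = 0)"

definition linearizes :: "complex ^ 'n ^ 'n \<Rightarrow> 'n::finite vfps \<Rightarrow> 'n vfps \<Rightarrow> bool" where
  "linearizes A F H \<longleftrightarrow>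
     (\<exists>h\<in>V 1. H = id_series + h) \<and> F \<circ>\<^sub>V H = H \<circ>\<^sub>V linear_series A"

definition linearization :: "complex ^ 'n ^ 'n \<Rightarrow> 'n::finite vfps \<Rightarrow> 'n vfps" where
  "linearization A F = (THE H. linearizes A F H)"


section \<open>The classes of formal power series\<close>

text \<open>Sequences are indexed from \<open>1\<close>; the value at \<open>0\<close> is never used.\<close>

definition weight_seq :: "(nat \<Rightarrow> real) \<Rightarrow> bool" where
  "weight_seq M \<longleftrightarrow>
     (\<forall>k\<ge>1. M k > 0) \<and>
     (INF k\<in>{1..}. root k (M k)) > 0 \<and>
     (\<exists>C1>0. \<forall>k\<ge>1. M (k + 1) \<le> C1 ^ (k + 1) * M k) \<and>
     (\<forall>k\<ge>1. M (k + 1) ^ 2 \<le> M k * M (k + 2)) \<and>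
     (\<forall>k\<ge>1. \<forall>l\<ge>1. M k * M l \<le> M (k + l - 1))"

definition series_class :: "(nat \<Rightarrow> real) \<Rightarrow> 'n::finite vfps set" where
  "series_class M = {F. \<exists>A>0. \<exists>B>0. \<forall>\<alpha>. mdeg \<alpha> \<ge> 1 \<longrightarrow>
     norm (vcoeff F \<alpha>) \<le> A * B ^ mdeg \<alpha> * M (mdeg \<alpha>)}"

definition taylor_at_0 :: "'n::finite vfps \<Rightarrow> (complex ^ 'n \<Rightarrow> complex ^ 'n) \<Rightarrow> bool" where
  "taylor_at_0 F f \<longleftrightarrow>
     (\<forall>\<^sub>F z in nhds 0. ((\<lambda>\<alpha>. mpow z \<alpha> *s vcoeff F \<alpha>) has_sum f z) UNIV)"

text \<open>
  A germ of analytic diffeomorphism of \<open>(\<complex>\<^sup>n, 0)\<close>, given by its Taylor series: the germ of an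
  analytic map fixing \<open>0\<close> which has an analytic local inverse fixing \<open>0\<close>.
\<close>

definition analytic_diffeo_germ :: "'n::finite vfps \<Rightarrow> bool" where
  "analytic_diffeo_germ F \<longleftrightarrow>
     (\<exists>f G g. F \<in> V 0 \<and> G \<in> V 0 \<and> taylor_at_0 F f \<and> taylor_at_0 G g \<and>
        (\<forall>\<^sub>F z in nhds 0. g (f z) = z \<and> f (g z) = z))"


section \<open>Small divisors\<close>

definition Omega_tilde :: "complex ^ 'n::finite \<Rightarrow> nat \<Rightarrow> real" where
  "Omega_tilde lam p =
     (MIN j. INF \<nu>\<in>{\<nu> :: int ^ 'n. zdeg \<nu> < p \<and> \<nu> \<noteq> axis j 1}. cmod (zpow lam \<nu> - lam $ j))"

definition dist_to_int :: "real \<Rightarrow> real" where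
  "dist_to_int x = \<bar>x - of_int (round x)\<bar>"

text \<open>
  The vector \<open>\<omega>\<close> with \<open>\<lambda>\<^sub>j = e\<^bsup>2\<pi>i\<omega>\<^sub>j\<^esup>\<close>; lemma \<open>rotation_vector\<close> below shows that for non-resonant
  \<open>\<lambda>\<close> on the unit torus it is the only such vector with entries in \<open>(-1/2, 1/2)\<close>, and that its
  entries are irrational.
\<close>

definition rotation_vector :: "complex ^ 'n \<Rightarrow> real ^ 'n" where
  "rotation_vector lam = (\<chi> j. Arg (lam $ j) / (2 * pi))"

definition Omega :: "real ^ 'n::finite \<Rightarrow> nat \<Rightarrow> real" where
  "Omega \<omega> p =
     (MIN \<nu>\<in>{\<nu> :: int ^ 'n. 0 < zdeg \<nu> \<and> zdeg \<nu> \<le> p}. dist_to_int (\<Sum>j\<in>UNIV. of_int (\<nu> $ j) * \<omega> $ j))"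

definition increasing_pos :: "(nat \<Rightarrow> nat) \<Rightarrow> bool" where
  "increasing_pos p \<longleftrightarrow> strict_mono p \<and> p 0 \<ge> 1"

text \<open>
  The positivity clauses below encode the convention that conditions involving \<open>1 / \<Omega>\<close> fail when
  \<open>\<Omega>\<close> vanishes.  For non-resonant \<open>\<lambda>\<close> on the unit torus
  \<open>Omega_tilde lam p\<close> tends to \<open>0\<close>, so the terms of the series are eventually
  nonnegative, so convergence is the same as the sum being less than \<open>+\<infinity>\<close>.
\<close>

definition bruno_condition :: "complex ^ 'n::finite \<Rightarrow> bool" where
  "bruno_condition lam \<longleftrightarrow>
     (\<exists>p. increasing_pos p \<and> (\<forall>k. Omega_tilde lam (p (k + 1)) > 0) \<and>
        summable (\<lambda>k. ln (inverse (Omega_tilde lam (p (k + 1)))) / real (p k)))"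

definition kappa :: "(nat \<Rightarrow> nat) \<Rightarrow> nat ^ 'n::finite \<Rightarrow> nat" where
  "kappa p \<alpha> = (THE k. p k \<le> mdeg \<alpha> \<and> mdeg \<alpha> < p (k + 1))"

definition limsup_condition :: "complex ^ 'n::finite \<Rightarrow> (nat \<Rightarrow> real) \<Rightarrow> bool" where
  "limsup_condition lam R \<longleftrightarrow>
     (\<exists>p. increasing_pos p \<and> (\<forall>m. Omega (rotation_vector lam) (p (m + 1)) > 0) \<and>
        Limsup (filtercomap mdeg at_top)
          (\<lambda>\<alpha> :: nat ^ 'n. ereal
             (2 * (\<Sum>m\<le>kappa p \<alpha>. ln (inverse (Omega (rotation_vector lam) (p (m + 1)))) / real (p m))
              - 1 / real (mdeg \<alpha>) * ln (R (mdeg \<alpha>)))) < \<infinity>)"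


subsection \<open>Existence and uniqueness of the linearization\<close>

definition ord_ge :: "nat \<Rightarrow> 'n::finite mfps \<Rightarrow> bool" where
  "ord_ge d f \<longleftrightarrow> (\<forall>\<alpha>. mdeg \<alpha> < d \<longrightarrow> mcoeff f \<alpha> = 0)"

lemma ord_geD: "ord_ge d f \<Longrightarrow> mdeg \<alpha> < d \<Longrightarrow> mcoeff f \<alpha> = 0"
  by (simp add: ord_ge_def)

lemma ord_ge_mult:
  assumes "ord_ge a f" "ord_ge b g"
  shows "ord_ge (a + b) (f * g)"
  unfolding ord_ge_def
proof (intro allI impI)
  fix \<alpha> :: "nat ^ 'a" assume \<alpha>: "mdeg \<alpha> < a + b"
  have "mcoeff f \<beta> * mcoeff g \<gamma> = 0" if "(\<beta>, \<gamma>) \<in> msplits \<alpha>" for \<beta> \<gamma>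
  proof -
    have "mdeg \<beta> + mdeg \<gamma> = mdeg \<alpha>" using that by (auto simp: msplits_def)
    then have "mdeg \<beta> < a \<or> mdeg \<gamma> < b" using \<alpha> by linarith
    then show ?thesis using assms by (auto simp: ord_ge_def)
  qed
  then show "mcoeff (f * g) \<alpha> = 0"
    unfolding mcoeff_mult by (intro sum.neutral) auto
qed

definition close_upto :: "nat \<Rightarrow> nat \<Rightarrow> 'n::finite mfps \<Rightarrow> 'n mfps \<Rightarrow> bool" where
  "close_upto e k f g \<longleftrightarrow> ord_ge k f \<and> ord_ge k g \<and> ord_ge (e + k) (f - g)"

lemma close_upto_mult:
  assumes "close_upto e k f g" "close_upto e k' f' g'"
  shows "close_upto e (k + k') (f * f') (g * g')"
proof -
  have "ord_ge (k + (e + k')) (f * (f' - g'))" "ord_ge ((e + k) + k') ((f - g) * g')"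
    using assms by (auto intro!: ord_ge_mult simp: close_upto_def)
  moreover have "f * f' - g * g' = f * (f' - g') + (f - g) * g'"
    by (simp add: algebra_simps)
  ultimately have "ord_ge (e + (k + k')) (f * f' - g * g')"
    by (simp add: ord_ge_def)
  then show ?thesis using assms by (auto intro!: ord_ge_mult simp: close_upto_def)
qed

lemma close_upto_one: "close_upto e 0 1 1"
  by (simp add: close_upto_def ord_ge_def)

lemma close_upto_power: "close_upto e 1 f g \<Longrightarrow> close_upto e k (f ^ k) (g ^ k)"
proof (induction k)
  case (Suc k)
  then show ?case using close_upto_mult[of e 1 f g k "f ^ k" "g ^ k"] by simp
qed (simp add: close_upto_one)

definition mono_at :: "'n::finite vfps \<Rightarrow> nat ^ 'n \<Rightarrow> 'n mfps" where
  "mono_at G \<alpha> = (\<Prod>i\<in>UNIV. (G $ i) ^ (\<alpha> $ i))"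

lemma close_upto_mono_at:
  assumes "\<And>i. close_upto e 1 (G $ i) (G' $ i)"
  shows "close_upto e (mdeg \<alpha>) (mono_at G \<alpha>) (mono_at G' \<alpha>)"
proof -
  have "close_upto e (\<Sum>i\<in>S. \<alpha> $ i) (\<Prod>i\<in>S. (G $ i) ^ (\<alpha> $ i)) (\<Prod>i\<in>S. (G' $ i) ^ (\<alpha> $ i))"
    if "finite S" for S
    using that by (induction S) (auto simp: close_upto_one intro!: close_upto_mult close_upto_power assms)
  then show ?thesis by (simp add: mdeg_def mono_at_def)
qed

lemma mono_at_axis [simp]: "mono_at G (axis j 1) = G $ j"
proof -
  have "mono_at G (axis j 1) = (\<Prod>i\<in>UNIV. if i = j then G $ j else 1)"
    unfolding mono_at_def by (rule prod.cong) (auto simp: axis_def)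
  then show ?thesis by simp
qed

lemma mcoeff_compose:
  "mcoeff (mfps_compose f G) \<beta> = (\<Sum>\<alpha> | mdeg \<alpha> \<le> mdeg \<beta>. mcoeff f \<alpha> * mcoeff (mono_at G \<alpha>) \<beta>)"
  by (simp add: mfps_compose_def mono_at_def)

lemma mcoeff_linear_series:
  "mcoeff (linear_series A $ i) \<alpha> = (\<Sum>j\<in>UNIV. if \<alpha> = axis j 1 then A $ i $ j else 0)"
  by (simp add: linear_series_def)

lemma mcoeff_compose_linear:
  assumes "\<And>i. ord_ge 1 (G $ i)"
  shows "mcoeff (mfps_compose (linear_series A $ i) G) \<beta> = (\<Sum>j\<in>UNIV. A $ i $ j * mcoeff (G $ j) \<beta>)"
proof -
  have "mcoeff (mfps_compose (linear_series A $ i) G) \<beta> =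
      (\<Sum>j\<in>UNIV. \<Sum>\<alpha> | mdeg \<alpha> \<le> mdeg \<beta>. (if \<alpha> = axis j 1 then A $ i $ j * mcoeff (G $ j) \<beta> else 0))"
    unfolding mcoeff_compose mcoeff_linear_series sum_distrib_right
    by (subst sum.swap) (intro sum.cong, auto simp flip: One_nat_def)
  also have "\<dots> = (\<Sum>j\<in>UNIV. A $ i $ j * mcoeff (G $ j) \<beta>)"
  proof (rule sum.cong)
    fix j
    have "mcoeff (G $ j) \<beta> = 0" if "mdeg \<beta> = 0"
      using assms[of j] that by (auto simp: ord_ge_def)
    then show "(\<Sum>\<alpha> | mdeg \<alpha> \<le> mdeg \<beta>. (if \<alpha> = axis j 1 then A $ i $ j * mcoeff (G $ j) \<beta> else 0))
        = A $ i $ j * mcoeff (G $ j) \<beta>"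
      by (auto simp del: mdeg_eq_0_iff)
  qed auto
  finally show ?thesis .
qed

lemma mcoeff_id_series:
  "mcoeff (id_series $ i) \<alpha> = (if \<alpha> = axis i 1 then 1 else 0)"
proof -
  have "mcoeff (id_series $ i) \<alpha> = (\<Sum>j\<in>UNIV. if j = i then (if \<alpha> = axis i 1 then 1 else 0) else 0)"
    unfolding mcoeff_linear_series by (rule sum.cong) (auto simp: mat_def)
  then show ?thesis by simp
qed

lemma V_iff: "F \<in> V j \<longleftrightarrow> (\<forall>i. ord_ge (Suc j) (F $ i))"
proof -
  have "vval F > enat j \<longleftrightarrow> vval F \<ge> enat (Suc j)"
    by (simp add: Suc_ile_eq)
  also have "\<dots> \<longleftrightarrow> (\<forall>\<alpha>. vcoeff F \<alpha> \<noteq> 0 \<longrightarrow> Suc j \<le> mdeg \<alpha>)"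
    by (auto simp: vval_def le_INF_iff)
  also have "\<dots> \<longleftrightarrow> (\<forall>i. ord_ge (Suc j) (F $ i))"
    by (auto simp: ord_ge_def vcoeff_def vec_eq_iff not_le) (meson not_le)
  finally show ?thesis by (simp add: V_def)
qed

definition mmonom :: "complex \<Rightarrow> nat ^ 'n::finite \<Rightarrow> 'n mfps" where
  "mmonom c \<alpha> = Abs_mfps (\<lambda>\<beta>. if \<beta> = \<alpha> then c else 0)"

lemma mmonom_mult: "mmonom c \<alpha> * mmonom d \<beta> = mmonom (c * d) (\<alpha> + \<beta>)"
proof (rule mfps_eqI)
  fix \<gamma>
  have "mcoeff (mmonom c \<alpha> * mmonom d \<beta>) \<gamma> =
    (\<Sum>p\<in>msplits \<gamma>. if p = (\<alpha>, \<beta>) then c * d else 0)"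
    unfolding mcoeff_mult by (rule sum.cong) (auto simp: mmonom_def split: if_splits)
  then show "mcoeff (mmonom c \<alpha> * mmonom d \<beta>) \<gamma> = mcoeff (mmonom (c * d) (\<alpha> + \<beta>)) \<gamma>"
    by (simp only: sum.delta[OF finite_msplits]) (auto simp: msplits_def mmonom_def)
qed

lemma mmonom_one: "mmonom 1 0 = 1"
  by (simp add: mfps_eq_iff mmonom_def mcoeff_one)

lemma mmonom_axis_power: "mmonom c (axis i 1) ^ k = mmonom (c ^ k) (axis i k)"
proof (induction k)
  case 0
  have "axis i 0 = (0 :: nat ^ 'a)" by (simp add: vec_eq_iff axis_def)
  then show ?case by (simp only: mmonom_one power_0)
next
  case (Suc k)
  have "axis i 1 + axis i k = (axis i (Suc k) :: nat ^ 'a)" by (simp add: vec_eq_iff axis_def)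
  then show ?case using Suc by (simp add: mmonom_mult)
qed

lemma mono_at_diag: "mono_at (linear_series (diag_matrix lam)) \<alpha> = mmonom (mpow lam \<alpha>) \<alpha>"
proof -
  have comp: "linear_series (diag_matrix lam) $ i = mmonom (lam $ i) (axis i 1)" for i
  proof (rule mfps_eqI)
    fix \<beta>
    have "mcoeff (linear_series (diag_matrix lam) $ i) \<beta> =
        (\<Sum>j\<in>UNIV. if j = i then (if \<beta> = axis i 1 then lam $ i else 0) else 0)"
      unfolding mcoeff_linear_series by (rule sum.cong) (auto simp: diag_matrix_def)
    then show "mcoeff (linear_series (diag_matrix lam) $ i) \<beta> = mcoeff (mmonom (lam $ i) (axis i 1)) \<beta>"
      by (simp add: mmonom_def)
  qed
  have "(\<Prod>i\<in>S. mmonom (lam $ i) (axis i 1) ^ (\<alpha> $ i)) =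
      mmonom (\<Prod>i\<in>S. lam $ i ^ (\<alpha> $ i)) (\<Sum>i\<in>S. axis i (\<alpha> $ i))" if "finite S" for S
    using that by (induction S) (auto simp: mmonom_one mmonom_axis_power mmonom_mult simp del: One_nat_def)
  moreover have "(\<Sum>i\<in>UNIV. axis i (\<alpha> $ i)) = \<alpha>"
    by (simp add: vec_eq_iff axis_def if_distrib cong: if_cong)
  ultimately show ?thesis by (simp add: mono_at_def comp mpow_def)
qed

lemma mcoeff_compose_diag:
  "mcoeff (mfps_compose f (linear_series (diag_matrix lam))) \<beta> = mpow lam \<beta> * mcoeff f \<beta>"
proof -
  have "mcoeff (mfps_compose f (linear_series (diag_matrix lam))) \<beta> =
     (\<Sum>\<alpha> | mdeg \<alpha> \<le> mdeg \<beta>. if \<alpha> = \<beta> then mcoeff f \<beta> * mpow lam \<beta> else 0)"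
    unfolding mcoeff_compose by (rule sum.cong) (auto simp: mono_at_diag mmonom_def)
  then show ?thesis by simp
qed

lemma mpow_axis [simp]: "mpow lam (axis j 1) = lam $ j"
proof -
  have "mpow lam (axis j 1) = (\<Prod>i\<in>UNIV. if i = j then lam $ j else 1)"
    unfolding mpow_def by (rule prod.cong) (auto simp: axis_def)
  then show ?thesis by simp
qed

text \<open>The recursion for the coefficients of the linearization, as a fixed point problem.\<close>

definition lin_step :: "complex ^ 'n \<Rightarrow> 'n::finite vfps \<Rightarrow> 'n vfps \<Rightarrow> 'n vfps" where
  "lin_step lam f G = (\<chi> i. Abs_mfps (\<lambda>\<beta>. if mdeg \<beta> \<le> 1 then mcoeff (id_series $ i) \<beta>
     else mcoeff (mfps_compose (f $ i) G) \<beta> / (mpow lam \<beta> - lam $ i)))"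

lemma mcoeff_lin_step:
  "mcoeff (lin_step lam f G $ i) \<beta> = (if mdeg \<beta> \<le> 1 then mcoeff (id_series $ i) \<beta>
     else mcoeff (mfps_compose (f $ i) G) \<beta> / (mpow lam \<beta> - lam $ i))"
  by (simp add: lin_step_def)

lemma ord_ge_lin_step: "ord_ge 1 (lin_step lam f G $ i)"
  by (auto simp: ord_ge_def mcoeff_lin_step mcoeff_id_series)

lemma lin_step_close_upto:
  assumes "f \<in> V 1" "\<And>i. close_upto e 1 (G $ i) (G' $ i)"
  shows "close_upto (Suc e) 1 (lin_step lam f G $ i) (lin_step lam f G' $ i)"
proof -
  have "mcoeff (mfps_compose (f $ i) G) \<beta> = mcoeff (mfps_compose (f $ i) G') \<beta>" if "mdeg \<beta> \<le> Suc e" for \<beta>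
    unfolding mcoeff_compose
  proof (rule sum.cong)
    fix \<alpha> :: "nat ^ 'a"
    show "mcoeff (f $ i) \<alpha> * mcoeff (mono_at G \<alpha>) \<beta> = mcoeff (f $ i) \<alpha> * mcoeff (mono_at G' \<alpha>) \<beta>"
    proof (cases "mdeg \<alpha> < 2")
      case True
      then show ?thesis using assms(1) by (simp add: V_iff ord_ge_def)
    next
      case False
      have "ord_ge (e + mdeg \<alpha>) (mono_at G \<alpha> - mono_at G' \<alpha>)"
        using close_upto_mono_at[OF assms(2)] by (simp add: close_upto_def)
      then have "mcoeff (mono_at G \<alpha> - mono_at G' \<alpha>) \<beta> = 0"
        by (rule ord_geD) (use False that in simp)
      then show ?thesis by simp
    qed
  qed auto
  then have "mcoeff (lin_step lam f G $ i) \<beta> = mcoeff (lin_step lam f G' $ i) \<beta>" if "mdeg \<beta> \<le> Suc e" for \<beta>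
    using that by (simp add: mcoeff_lin_step)
  then show ?thesis using ord_ge_lin_step by (auto simp: close_upto_def ord_ge_def)
qed

lemma linearizes_iff_fixed:
  assumes "\<not> resonant lam" "f \<in> V 1"
  shows "linearizes (diag_matrix lam) (linear_series (diag_matrix lam) + f) H \<longleftrightarrow> H = lin_step lam f H"
proof -
  have V: "(\<exists>h\<in>V 1. H = id_series + h) \<longleftrightarrow>
      (\<forall>i \<beta>. mdeg \<beta> \<le> 1 \<longrightarrow> mcoeff (H $ i) \<beta> = mcoeff (id_series $ i) \<beta>)"
  proof -
    have "(\<exists>h\<in>V 1. H = id_series + h) \<longleftrightarrow> H - id_series \<in> V 1"
      by (metis add_diff_cancel_left' diff_add_cancel)
    then show ?thesis by (auto simp: V_iff ord_ge_def)
  qed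
  have eq: "linear_series (diag_matrix lam) + f \<circ>\<^sub>V H = H \<circ>\<^sub>V linear_series (diag_matrix lam) \<longleftrightarrow>
      (\<forall>i \<beta>. mdeg \<beta> > 1 \<longrightarrow> mcoeff (H $ i) \<beta> = mcoeff (mfps_compose (f $ i) H) \<beta> / (mpow lam \<beta> - lam $ i))"
    if H: "\<And>i \<beta>. mdeg \<beta> \<le> 1 \<Longrightarrow> mcoeff (H $ i) \<beta> = mcoeff (id_series $ i) \<beta>"
  proof -
    have H1: "ord_ge 1 (H $ i)" for i
      by (auto simp: ord_ge_def H mcoeff_id_series)
    have l: "mcoeff ((linear_series (diag_matrix lam) + f \<circ>\<^sub>V H) $ i) \<beta> =
        lam $ i * mcoeff (H $ i) \<beta> + mcoeff (mfps_compose (f $ i) H) \<beta>" for i \<beta>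
    proof -
      have "mcoeff ((linear_series (diag_matrix lam) + f \<circ>\<^sub>V H) $ i) \<beta> =
         mcoeff (mfps_compose (linear_series (diag_matrix lam) $ i) H) \<beta> + mcoeff (mfps_compose (f $ i) H) \<beta>"
        by (simp add: vfps_compose_def mcoeff_compose distrib_right sum.distrib)
      also have "mcoeff (mfps_compose (linear_series (diag_matrix lam) $ i) H) \<beta> = lam $ i * mcoeff (H $ i) \<beta>"
        by (simp add: mcoeff_compose_linear[OF H1] diag_matrix_def if_distrib[of "\<lambda>x. x * _"] cong: if_cong)
      finally show ?thesis .
    qed
    have r: "mcoeff ((H \<circ>\<^sub>V linear_series (diag_matrix lam)) $ i) \<beta> = mpow lam \<beta> * mcoeff (H $ i) \<beta>" for i \<beta>
      by (simp add: vfps_compose_def mcoeff_compose_diag)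
    have "lam $ i * mcoeff (H $ i) \<beta> + mcoeff (mfps_compose (f $ i) H) \<beta> = mpow lam \<beta> * mcoeff (H $ i) \<beta> \<longleftrightarrow>
       (mdeg \<beta> > 1 \<longrightarrow> mcoeff (H $ i) \<beta> = mcoeff (mfps_compose (f $ i) H) \<beta> / (mpow lam \<beta> - lam $ i))" for i \<beta>
    proof (cases "mdeg \<beta> > 1")
      case True
      then have "mpow lam \<beta> - lam $ i \<noteq> 0" using assms(1) by (auto simp: resonant_def)
      then show ?thesis using True by (auto simp: field_simps)
    next
      case False
      have "mcoeff (mfps_compose (f $ i) H) \<beta> = 0"
        unfolding mcoeff_compose using assms(2) False
        by (intro sum.neutral) (auto simp: V_iff ord_ge_def)
      moreover have "lam $ i * mcoeff (H $ i) \<beta> = mpow lam \<beta> * mcoeff (H $ i) \<beta>"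
        using False H[of \<beta> i] by (auto simp: mcoeff_id_series mpow_axis[unfolded One_nat_def])
      ultimately show ?thesis using False by simp
    qed
    then show ?thesis by (simp add: vec_eq_iff mfps_eq_iff l r)
  qed
  have fixed: "H = lin_step lam f H \<longleftrightarrow>
      (\<forall>i \<beta>. mdeg \<beta> \<le> 1 \<longrightarrow> mcoeff (H $ i) \<beta> = mcoeff (id_series $ i) \<beta>) \<and>
      (\<forall>i \<beta>. mdeg \<beta> > 1 \<longrightarrow> mcoeff (H $ i) \<beta> = mcoeff (mfps_compose (f $ i) H) \<beta> / (mpow lam \<beta> - lam $ i))"
    unfolding vec_eq_iff[of H] mfps_eq_iff mcoeff_lin_step by (auto simp: not_le)
  show ?thesis
    unfolding linearizes_def V fixed using eq by blast
qed

theorem linearization_ex1: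
  assumes "\<not> resonant lam" "f \<in> V 1"
  shows "\<exists>!H. linearizes (diag_matrix lam) (linear_series (diag_matrix lam) + f) H"
  unfolding linearizes_iff_fixed[OF assms]
proof (rule ex_ex1I)
  let ?T = "lin_step lam f"
  define G where "G n = (?T ^^ n) id_series" for n
  have GS: "G (Suc n) = ?T (G n)" for n by (simp add: G_def)
  have G1: "ord_ge 1 (G n $ i)" for n i
    proof (cases n)
    case 0
    then show ?thesis by (auto simp: G_def ord_ge_def mcoeff_id_series)
  next
    case (Suc m)
    then show ?thesis using ord_ge_lin_step[of lam f "G m" i] by (simp add: GS)
  qed
  have step: "close_upto n 1 (G n $ i) (G (Suc n) $ i)" for n i
  proof (induction n arbitrary: i)
    case 0
    show ?case using G1[of 0 i] G1[of "Suc 0" i] by (simp add: close_upto_def ord_ge_def)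
  next
    case (Suc n)
    show ?case unfolding GS[of n] GS[of "Suc n"] using Suc
      by (intro lin_step_close_upto[OF assms(2)]) (simp add: GS)
  qed
  have agree: "mcoeff (G m $ i) \<beta> = mcoeff (G n $ i) \<beta>" if "mdeg \<beta> \<le> n" "n \<le> m" for m n i \<beta>
    using that(2)
  proof (induction m rule: dec_induct)
    case (step k)
    then show ?case using \<open>\<And>n i. close_upto n 1 (G n $ i) (G (Suc n) $ i)\<close>[of k i] that(1)
      by (auto simp: close_upto_def ord_ge_def less_Suc_eq_le)
  qed simp
  define H :: "'a vfps" where "H = (\<chi> i. Abs_mfps (\<lambda>\<beta>. mcoeff (G (mdeg \<beta>) $ i) \<beta>))"
  have HG: "mcoeff (H $ i) \<beta> = mcoeff (G n $ i) \<beta>" if "mdeg \<beta> \<le> n" for i \<beta> n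
    using agree[of \<beta> "mdeg \<beta>" n i] that by (simp add: H_def)
  have cl: "close_upto n 1 (H $ i) (G n $ i)" for n i
    using G1[of n i] by (auto simp: close_upto_def ord_ge_def HG[of _ n] less_Suc_eq_le)
  have "H = ?T H"
    unfolding vec_eq_iff
  proof (intro allI mfps_eqI)
    fix i and \<beta> :: "nat ^ 'a"
    have "close_upto (Suc (mdeg \<beta>)) 1 (?T H $ i) (?T (G (mdeg \<beta>)) $ i)"
      by (rule lin_step_close_upto[OF assms(2) cl])
    then have "mcoeff (?T H $ i) \<beta> = mcoeff (G (Suc (mdeg \<beta>)) $ i) \<beta>"
      by (auto simp: close_upto_def ord_ge_def GS)
    then show "mcoeff (H $ i) \<beta> = mcoeff (?T H $ i) \<beta>" by (simp add: HG[of \<beta> "Suc (mdeg \<beta>)"])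
  qed
  then show "\<exists>H. H = ?T H" ..
next
  fix H H' assume H: "H = lin_step lam f H" and H': "H' = lin_step lam f H'"
  have "close_upto n 1 (H $ i) (H' $ i)" for n i
  proof (induction n arbitrary: i)
    case 0
    show ?case using ord_ge_lin_step[of lam f H i] ord_ge_lin_step[of lam f H' i]
      by (simp add: H[symmetric] H'[symmetric] close_upto_def ord_ge_def)
  next
    case (Suc n)
    then show ?case using lin_step_close_upto[OF assms(2), of n H H' lam i] by (simp add: H[symmetric] H'[symmetric])
  qed
  then have "mcoeff (H $ i) \<beta> = mcoeff (H' $ i) \<beta>" for i \<beta>
    by (force simp: close_upto_def ord_ge_def dest: spec[of _ \<beta>])
  then show "H = H'" by (simp add: vec_eq_iff mfps_eq_iff)
qed


subsection \<open>The rotation vector\<close>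

lemma mpow_axis_power: "mpow lam (axis j k) = lam $ j ^ k"
proof -
  have "mpow lam (axis j k) = (\<Prod>i\<in>UNIV. if i = j then lam $ j ^ k else 1)"
    unfolding mpow_def by (rule prod.cong) (auto simp: axis_def)
  then show ?thesis by simp
qed

lemma rotation_vector:
  assumes "cmod (lam $ j) = 1" "\<not> resonant lam"
  shows "lam $ j = exp (2 * pi * \<i> * rotation_vector lam $ j)"
    and "rotation_vector lam $ j \<in> {-1/2<..<1/2} - \<rat>"
    and "lam $ j = exp (2 * pi * \<i> * complex_of_real w) \<Longrightarrow> w \<in> {-1/2<..<1/2} \<Longrightarrow> w = rotation_vector lam $ j"
proof -
  let ?w = "rotation_vector lam $ j"
  have w: "2 * pi * ?w = Arg (lam $ j)" by (simp add: rotation_vector_def)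
  have nz: "lam $ j \<noteq> 0" using assms(1) by auto
  have c: "lam $ j = cis (2 * pi * ?w)"
    unfolding w using cis_Arg[OF nz] assms(1) by (simp add: sgn_eq)
  then show "lam $ j = exp (2 * pi * \<i> * ?w)" by (simp add: cis_conv_exp algebra_simps)
  have irr: "?w \<notin> \<rat>"
  proof
    assume "?w \<in> \<rat>"
    then obtain a b :: int where ab: "b > 0" "?w = of_int a / of_int b"
      by (elim Rats_cases') auto
    have "lam $ j ^ nat b = cis (of_int (nat b) * (2 * pi * ?w))"
      using ab(1) by (subst c) (simp add: Complex.DeMoivre)
    also have "of_int (nat b) * (2 * pi * ?w) = 2 * pi * of_int a" using ab by simp
    also have "cis (2 * pi * of_int a) = 1" by (rule cis_multiple_2pi) auto
    finally have "mpow lam (axis j (Suc (nat b))) - lam $ j = 0" by (simp add: mpow_axis_power)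
    moreover have "mdeg (axis j (Suc (nat b)) :: nat ^ 'a) \<ge> 2" using ab by simp
    ultimately show False using assms(2) unfolding resonant_def by blast
  qed
  have "(1/2 :: real) \<in> \<rat>" by simp
  then have "?w \<noteq> 1/2" using irr by metis
  moreover have "-1/2 < ?w" "?w \<le> 1/2"
    using Arg_bounded[of "lam $ j"] by (auto simp: rotation_vector_def field_simps)
  ultimately show "?w \<in> {-1/2<..<1/2} - \<rat>" using irr by auto
  show "w = ?w" if "lam $ j = exp (2 * pi * \<i> * complex_of_real w)" "w \<in> {-1/2<..<1/2}"
  proof -
    have "sgn (lam $ j) = cis (2 * pi * w)" using that assms(1) by (simp add: sgn_eq cis_conv_exp algebra_simps)
    moreover have "- pi < 2 * pi * w" "2 * pi * w \<le> pi"
      using that(2) mult_strict_left_mono[of "-1/2" w "2 * pi"] mult_strict_left_mono[of w "1/2" "2 * pi"]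
      by auto
    ultimately have "Arg (lam $ j) = 2 * pi * w" by (intro cis_Arg_unique)
    then show ?thesis by (simp add: rotation_vector_def)
  qed
qed

end

theory Submission
  imports Defs
begin

text \<open>
  The coefficients of the linearization satisfy
  \<open>(\<lambda>\<^sup>\<alpha> - \<lambda>\<^sub>i) h\<^bsub>\<alpha>,i\<^esub> = [z\<^sup>\<alpha>] f\<^sub>i(H(z))\<close>.  Unfolding this recursion writes \<open>h\<^bsub>\<alpha>,i\<^esub>\<close> as a sum over
  trees with \<open>|\<alpha>|\<close> leaves, where every inner node with \<open>k\<close> children contributes a coefficient of \<open>f\<close>
  of degree \<open>k\<close> and the inverse of a divisor \<open>\<lambda>\<^sup>\<beta> - \<lambda>\<^sub>j\<close>.  Three separate estimates give the theorem.

  The coefficients of \<open>f\<close> contribute a geometric factor and the product of the weights \<open>M k\<close>.  As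
  \<open>M\<^sub>k M\<^sub>l \<le> M\<^bsub>k+l-1\<^esub>\<close>, that product is at most a constant times the weight of the degree
  (\<open>arity_weight_le\<close>).

  The number of trees does not have to be computed.  The largest weight of a forest with given
  arity and index is supermultiplicative.  After division by it the recursion is that of a
  convergent problem without divisors, which the classical majorant method settles
  (\<open>majorized_lin_step\<close>, \<open>linearization_majorized\<close>).

  The product of the inverse divisors along one tree is controlled by Bruno's counting argument.
  If \<open>\<lambda>\<^bsup>\<alpha>+\<beta>\<^esup> - \<lambda>\<^sub>i\<close> and \<open>\<lambda>\<^sup>\<beta> - \<lambda>\<^sub>j\<close> are both smaller than half of a lower bound that is valid for all divisors
  of degree below \<open>p\<close>, then \<open>|\<alpha>|\<close> cannot be small compared to \<open>p\<close>.  Hence a tree of degree \<open>d\<close> has at most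
  \<open>2 d / p\<close> such small divisors (\<open>graft_count_le\<close>).  Summing over the levels \<open>p\<^sub>0 < p\<^sub>1 < \<dots>\<close> bounds the
  product by the exponential of \<open>d (c + 2 \<Sum>\<^bsub>v\<le>\<kappa>\<^esub> ln (1 / T\<^bsub>v+1\<^esub>) / p\<^sub>v)\<close>, where twice the threshold \<open>T\<^sub>v\<close> is a
  lower bound for the divisors of degree below \<open>p\<^sub>v\<close> (\<open>inv_divisors_le\<close>).

  It remains to choose the levels.  Under the Bruno condition half of \<open>Omega_tilde\<close> is taken, and
  the sum stays bounded.  Under the limsup conditions \<open>\<Omega>\<close> itself is taken: the divisors of
  degree below \<open>p\<close> are at least \<open>2 \<Omega>(p)\<close>, so the sum is exactly the one in the condition, and the
  exponential is at most a geometric factor times \<open>N / M\<close>.  For an analytic germ \<open>M = 1\<close> is used.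
\<close>

section \<open>Forests and their weights\<close>

text \<open>
  Expanding the recursion for the coefficients of the linearization produces sums over forests of
  trees.  A leaf \<open>j\<close> stands for the linear term \<open>z\<^sub>j\<close> of \<open>H\<^sub>j\<close>, \<open>Join\<close> for a product of two
  partial products, and \<open>Graft i a b\<close> for one use of the recursion: the product of at least two
  factors represented by \<open>Join a b\<close> is multiplied by a coefficient of \<open>f\<^sub>i\<close> and divided by
  \<open>\<lambda>\<^sup>\<alpha> - \<lambda>\<^sub>i\<close>.  The result is a single factor, hence a forest of arity 1.  Since a graft always
  sits on a join, the same divisor never occurs twice in a row: the degree drops strictly from a
  graft to the trees below it.
\<close>

datatype 'n forest =
  Leaf 'n
| Join "'n forest" "'n forest"
| Graft 'n "'n forest" "'n forest"

primrec idx :: "'n::finite forest \<Rightarrow> nat ^ 'n" where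
  "idx (Leaf j) = axis j 1"
| "idx (Join a b) = idx a + idx b"
| "idx (Graft i a b) = idx a + idx b"

primrec arity :: "'n forest \<Rightarrow> nat" where
  "arity (Leaf j) = 1"
| "arity (Join a b) = arity a + arity b"
| "arity (Graft i a b) = 1"

primrec inv_divisors :: "complex ^ 'n \<Rightarrow> 'n::finite forest \<Rightarrow> real" where
  "inv_divisors lam (Leaf j) = 1"
| "inv_divisors lam (Join a b) = inv_divisors lam a * inv_divisors lam b"
| "inv_divisors lam (Graft i a b) =
     inv_divisors lam a * inv_divisors lam b / cmod (mpow lam (idx a + idx b) - lam $ i)"

text \<open>
  A graft joining \<open>k\<close> trees uses a coefficient of \<open>f\<close> of degree \<open>k\<close>, whose size is measured by
  \<open>M k\<close>.
\<close>

primrec arity_weight :: "(nat \<Rightarrow> real) \<Rightarrow> 'n forest \<Rightarrow> real" where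
  "arity_weight M (Leaf j) = 1"
| "arity_weight M (Join a b) = arity_weight M a * arity_weight M b"
| "arity_weight M (Graft i a b) =
     M (arity a + arity b) * (arity_weight M a * arity_weight M b)"

primrec graft_count :: "(nat ^ 'n \<Rightarrow> 'n \<Rightarrow> bool) \<Rightarrow> 'n::finite forest \<Rightarrow> nat" where
  "graft_count S (Leaf j) = 0"
| "graft_count S (Join a b) = graft_count S a + graft_count S b"
| "graft_count S (Graft i a b) =
     graft_count S a + graft_count S b + of_bool (S (idx a + idx b) i)"

lemma arity_pos: "arity t \<ge> 1"
  by (induction t) auto

lemma mdeg_idx_pos: "mdeg (idx t) \<ge> 1"
  by (induction t) (auto simp del: mdeg_eq_0_iff One_nat_def)

lemma graft_count_less_mdeg: "graft_count S t < mdeg (idx t)"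
proof (induction t)
  case (Leaf j)
  show ?case using mdeg_axis[of j 1] by (simp del: mdeg_axis)
qed auto

lemma finite_forests: "finite {t :: 'n::finite forest. mdeg (idx t) \<le> d}"
proof (induction d)
  case 0
  have "{t :: 'n forest. mdeg (idx t) \<le> 0} = {}" using mdeg_idx_pos not_one_le_zero by (metis (mono_tags, lifting) empty_Collect_eq le_zero_eq)
  then show ?case by (metis finite.emptyI)
next
  case (Suc d)
  let ?D = "{t :: 'n forest. mdeg (idx t) \<le> d}"
  have "t \<in> range Leaf \<union> case_prod Join ` (?D \<times> ?D) \<union> (\<lambda>(i, a, b). Graft i a b) ` (UNIV \<times> ?D \<times> ?D)"
    if "mdeg (idx t) \<le> Suc d" for t :: "'n forest"
  proof (cases t)
    case (Join a b)
    then show ?thesis using that mdeg_idx_pos[of a] mdeg_idx_pos[of b] by (auto simp: image_iff)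
  next
    case (Graft i a b)
    then show ?thesis using that mdeg_idx_pos[of a] mdeg_idx_pos[of b] by (auto simp: image_iff)
  qed auto
  then have "{t :: 'n forest. mdeg (idx t) \<le> Suc d} \<subseteq>
     range Leaf \<union> case_prod Join ` (?D \<times> ?D) \<union> (\<lambda>(i, a, b). Graft i a b) ` (UNIV \<times> ?D \<times> ?D)"
    by blast
  then show ?case by (rule finite_subset) (use Suc in simp)
qed

lemma arity_weight_pos:
  assumes "\<And>k. k \<ge> 1 \<Longrightarrow> M k > 0"
  shows "arity_weight M t > 0"
proof (induction t)
  case (Graft i a b)
  then show ?case using assms[of "arity a + arity b"] arity_pos[of a] by simp
qed auto

text \<open>
  Property \<open>M\<^sub>k M\<^sub>l \<le> M\<^bsub>k+l-1\<^esub>\<close> collapses the weights of a tree into the single factor of its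
  degree: replacing a leaf by \<open>k\<close> leaves raises the degree by \<open>k - 1\<close>.  The shift \<open>r\<close> is what makes
  the induction work, because the trees next to the one under consideration count as leaves.
\<close>

lemma arity_weight_le:
  fixes M :: "nat \<Rightarrow> real"
  assumes pos: "\<And>k. k \<ge> 1 \<Longrightarrow> M k > 0"
    and mult: "\<And>k l. k \<ge> 1 \<Longrightarrow> l \<ge> 1 \<Longrightarrow> M k * M l \<le> M (k + l - 1)"
  shows "M (arity t + r) * arity_weight M t \<le> M (mdeg (idx t) + r)"
proof (induction t arbitrary: r)
  case (Leaf j)
  show ?case using mdeg_axis[of j 1] by (simp del: mdeg_axis)
next
  case (Join a b)
  have "M (arity (Join a b) + r) * arity_weight M (Join a b) =
      (M (arity a + (arity b + r)) * arity_weight M a) * arity_weight M b"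
    by (simp add: algebra_simps)
  also have "\<dots> \<le> M (mdeg (idx a) + (arity b + r)) * arity_weight M b"
    using Join(1)[of "arity b + r"] arity_weight_pos[of M b, OF pos] by (intro mult_right_mono) auto
  also have "\<dots> = M (arity b + (mdeg (idx a) + r)) * arity_weight M b" by (simp add: algebra_simps)
  also have "\<dots> \<le> M (mdeg (idx b) + (mdeg (idx a) + r))" by (rule Join(2))
  finally show ?case by (simp add: algebra_simps)
next
  case (Graft i a b)
  have "M (arity (Graft i a b) + r) * arity_weight M (Graft i a b) =
      (M (1 + r) * M (arity a + arity b)) * (arity_weight M a * arity_weight M b)"
    by simp
  also have "\<dots> \<le> M (arity a + (arity b + r)) * (arity_weight M a * arity_weight M b)"
    using mult[of "1 + r" "arity a + arity b"] arity_pos[of a]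
      arity_weight_pos[of M a, OF pos] arity_weight_pos[of M b, OF pos]
    by (intro mult_right_mono) (auto simp: algebra_simps)
  also have "\<dots> = (M (arity a + (arity b + r)) * arity_weight M a) * arity_weight M b" by simp
  also have "\<dots> \<le> M (mdeg (idx a) + (arity b + r)) * arity_weight M b"
    using Graft(1)[of "arity b + r"] arity_weight_pos[of M b, OF pos] by (intro mult_right_mono) auto
  also have "\<dots> = M (arity b + (mdeg (idx a) + r)) * arity_weight M b" by (simp add: algebra_simps)
  also have "\<dots> \<le> M (mdeg (idx b) + (mdeg (idx a) + r))" by (rule Graft(2))
  finally show ?case by (simp add: algebra_simps)
qed

section \<open>Counting small divisors\<close>

text \<open>
  A variant of Bruno's counting lemma.  Small divisors occur only in degree at
  least \<open>p\<close>, and along a branch two of them are separated by a degree gap of at least \<open>p / 2\<close>.  A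
  tree with the maximal number of small divisors therefore has them at about \<open>mdeg (idx t) / p\<close>
  disjoint subtrees of minimal degree \<open>p\<close>, and at the nodes of a binary tree joining these; the
  number of nodes is twice the number of leaves minus 1.

  The induction proves a second bound along with the first one: below a small divisor there is room
  for one more in the bound.  To see this, follow the branch downwards from that divisor.  If it
  runs into a tree with a small root, then the gap condition gives the room.  If it splits into two
  parts of degree at least \<open>p\<close>, then the summand \<open>-1\<close> of the bound occurs twice.  Otherwise at most one
  part can contain small divisors, and the other part is added to the gap.  If the branch ends
  without another small divisor, then the bound is at least 1 because the degree is at least \<open>p\<close>.
\<close>

lemma graft_count_le:
  fixes S :: "nat ^ 'n::finite \<Rightarrow> 'n \<Rightarrow> bool" and p :: nat
  assumes p: "p \<ge> 1"
    and deg: "\<And>\<alpha> i. S \<alpha> i \<Longrightarrow> p \<le> mdeg \<alpha>"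
    and nested: "\<And>\<alpha> \<beta> i j. S (\<alpha> + \<beta>) i \<Longrightarrow> S \<beta> j \<Longrightarrow> \<alpha> \<noteq> 0 \<Longrightarrow> p \<le> 2 * mdeg \<alpha>"
  shows "real (graft_count S t) \<le> max 0 (2 * mdeg (idx t) / p - 1)"
proof -
  \<comment> \<open>Sharper than the bound in the claim: no small divisor at all below degree \<open>p\<close>.\<close>
  define B where "B d = (if d < p then 0 else 2 * real d / p - 1)" for d
  have p0: "real p > 0" using p by simp
  have B_add: "B c + B d \<le> B (c + d)" for c d
    using p0 by (auto simp: B_def field_simps)
  have B_mono: "B c \<le> B d" if "c \<le> d" for c d
  proof -
    have "B (d - c) \<ge> 0" using p0 by (auto simp: B_def field_simps)
    then show ?thesis using B_add[of c "d - c"] that by simp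
  qed
  have B_shift: "B d + 1 \<le> B (e + d)" if "p \<le> d" "p \<le> 2 * e" for d e
  proof -
    have "real p \<le> 2 * real e" using that(2) by linarith
    then show ?thesis using that(1) p0 by (simp add: B_def field_simps)
  qed
  let ?main = "\<lambda>t. real (graft_count S t) \<le> B (mdeg (idx t))"
  let ?near = "\<lambda>t. \<forall>\<alpha> i. S (\<alpha> + idx t) i \<and> \<alpha> \<noteq> 0 \<longrightarrow>
     real (graft_count S t) + 1 \<le> B (mdeg \<alpha> + mdeg (idx t))"
  have near_join: "real (graft_count S a) + real (graft_count S b) + 1 \<le> B (mdeg \<alpha> + (mdeg (idx a) + mdeg (idx b)))"
    if a: "?main a" "?near a" and b: "?main b" "?near b" and S: "S (\<alpha> + (idx a + idx b)) i" for a b \<alpha> i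
  proof -
    have nz: "idx a \<noteq> 0" "idx b \<noteq> 0"
      using mdeg_idx_pos[of a] mdeg_idx_pos[of b] by auto
    consider "mdeg (idx a) < p" | "mdeg (idx b) < p" | "p \<le> mdeg (idx a)" "p \<le> mdeg (idx b)" by linarith
    then show ?thesis
    proof cases
      case 1
      then have "graft_count S a = 0" using a(1) by (simp add: B_def)
      moreover have "real (graft_count S b) + 1 \<le> B (mdeg (\<alpha> + idx a) + mdeg (idx b))"
        using S nz by (intro b(2)[rule_format, of _ i]) (auto simp: add.assoc vec_eq_iff)
      ultimately show ?thesis by (simp add: add.assoc)
    next
      case 2
      then have "graft_count S b = 0" using b(1) by (simp add: B_def)
      moreover have "real (graft_count S a) + 1 \<le> B (mdeg (\<alpha> + idx b) + mdeg (idx a))"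
        using S nz by (intro a(2)[rule_format, of _ i]) (auto simp: add_ac vec_eq_iff)
      ultimately show ?thesis by (simp add: add_ac)
    next
      case 3
      have "real (graft_count S a) + real (graft_count S b) + 1 \<le> B (mdeg (idx a)) + B (mdeg (idx b)) + 1"
        using a(1) b(1) by linarith
      also have "\<dots> = B (mdeg (idx a) + mdeg (idx b))" using 3 p0 by (simp add: B_def field_simps)
      also have "\<dots> \<le> B (mdeg \<alpha> + (mdeg (idx a) + mdeg (idx b)))" by (rule B_mono) simp
      finally show ?thesis .
    qed
  qed
  have "?main t \<and> ?near t"
  proof (induction t)
    case (Leaf j)
    have "1 \<le> B d" if "p \<le> d" for d using that p0 by (simp add: B_def field_simps)
    moreover have "B d \<ge> 0" for d using p0 by (simp add: B_def field_simps)
    ultimately show ?case using deg by fastforce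
  next
    case (Join a b)
    have "real (graft_count S a) + real (graft_count S b) \<le> B (mdeg (idx a) + mdeg (idx b))"
      using Join B_add[of "mdeg (idx a)" "mdeg (idx b)"] by linarith
    then show ?case using near_join[of a b] Join by auto
  next
    case (Graft i a b)
    have sum: "real (graft_count S a) + real (graft_count S b) \<le> B (mdeg (idx a) + mdeg (idx b))"
      using Graft B_add[of "mdeg (idx a)" "mdeg (idx b)"] by linarith
    show ?case
    proof (cases "S (idx a + idx b) i")
      case True
      have main: "?main (Graft i a b)"
        using near_join[of a b 0 i] Graft True by simp
      have "?near (Graft i a b)"
      proof (intro allI impI)
        fix \<alpha> j assume *: "S (\<alpha> + idx (Graft i a b)) j \<and> \<alpha> \<noteq> 0"
        then have "p \<le> 2 * mdeg \<alpha>" using nested True by auto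
        then have "B (mdeg (idx (Graft i a b))) + 1 \<le> B (mdeg \<alpha> + mdeg (idx (Graft i a b)))"
          using deg[OF True] by (intro B_shift) auto
        then show "real (graft_count S (Graft i a b)) + 1 \<le> B (mdeg \<alpha> + mdeg (idx (Graft i a b)))"
          using main by linarith
      qed
      with main show ?thesis by blast
    next
      case False
      then show ?thesis using sum near_join[of a b] Graft by auto
    qed
  qed
  then have "real (graft_count S t) \<le> B (mdeg (idx t))" ..
  also have "\<dots> \<le> max 0 (2 * mdeg (idx t) / p - 1)" by (simp add: B_def)
  finally show ?thesis .
qed

text \<open>
  If \<open>\<epsilon> < T 0\<close>, then the last level \<open>v \<le> K\<close> with \<open>\<epsilon> < T v\<close> contributes \<open>ln (1 / T (v + 1)) \<ge> ln (1 / \<epsilon>)\<close>,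
  and all other contributions are nonnegative.  A divisor is charged to every level that it
  violates, so that the violations of each level can be counted separately.
\<close>

lemma ln_inverse_le_level_sum:
  fixes T :: "nat \<Rightarrow> real"
  assumes T: "\<And>v. 0 < T v" "\<And>v. T v \<le> 1" and eps: "T (Suc K) \<le> \<epsilon>"
  shows "ln (1 / \<epsilon>) \<le> ln (1 / T 0) + (\<Sum>v\<le>K. of_bool (\<epsilon> < T v) * ln (1 / T (Suc v)))"
  using eps
proof (induction K)
  case 0
  have e: "\<epsilon> > 0" using T(1)[of "Suc 0"] 0 by linarith
  have pos: "ln (1 / T v) \<ge> 0" for v using T by (simp add: ln_div)
  show ?case
  proof (cases "T 0 \<le> \<epsilon>")
    case True
    then show ?thesis using T(1)[of 0] e by (simp add: ln_div)
  next
    case False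
    have "ln (1 / \<epsilon>) \<le> ln (1 / T (Suc 0))"
      using 0 T(1)[of "Suc 0"] e by (simp add: ln_div)
    then show ?thesis using False pos[of 0] by simp
  qed
next
  case (Suc K)
  have e: "\<epsilon> > 0" using T(1)[of "Suc (Suc K)"] Suc.prems by linarith
  have pos: "ln (1 / T v) \<ge> 0" for v using T by (simp add: ln_div)
  show ?case
  proof (cases "T (Suc K) \<le> \<epsilon>")
    case True
    then show ?thesis using Suc.IH by simp
  next
    case False
    have "ln (1 / \<epsilon>) \<le> ln (1 / T (Suc (Suc K)))"
      using Suc.prems T(1)[of "Suc (Suc K)"] e by (simp add: ln_div)
    moreover have "0 \<le> (\<Sum>v\<le>K. of_bool (\<epsilon> < T v) * ln (1 / T (Suc v)))"
      using pos by (intro sum_nonneg mult_nonneg_nonneg) auto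
    ultimately show ?thesis using False pos[of 0] by simp
  qed
qed

lemma ln_inv_divisors_le_counts:
  fixes T :: "nat \<Rightarrow> real"
  assumes T: "\<And>v. 0 < T v" "\<And>v. T v \<le> 1"
    and low: "\<And>\<gamma> i. 2 \<le> mdeg \<gamma> \<Longrightarrow> mdeg \<gamma> \<le> d \<Longrightarrow> T (Suc K) \<le> cmod (mpow lam \<gamma> - lam $ i)"
    and "mdeg (idx t) \<le> d"
  shows "0 < inv_divisors lam t \<and> ln (inv_divisors lam t) \<le> graft_count (\<lambda>_ _. True) t * ln (1 / T 0) +
     (\<Sum>v\<le>K. graft_count (\<lambda>\<gamma> i. 2 \<le> mdeg \<gamma> \<and> cmod (mpow lam \<gamma> - lam $ i) < T v) t * ln (1 / T (Suc v)))"
  using assms(4)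
proof (induction t)
  case (Leaf j)
  then show ?case by simp
next
  case (Join a b)
  then show ?case
    by (simp add: ln_mult algebra_simps sum.distrib)
next
  case (Graft i a b)
  define \<epsilon> where "\<epsilon> = cmod (mpow lam (idx a + idx b) - lam $ i)"
  have d2: "2 \<le> mdeg (idx a + idx b)" using mdeg_idx_pos[of a] mdeg_idx_pos[of b] by simp
  have eps: "T (Suc K) \<le> \<epsilon>"
    unfolding \<epsilon>_def using low[OF d2] Graft.prems by simp
  then have e0: "\<epsilon> > 0" using T(1)[of "Suc K"] by linarith
  have "ln (inv_divisors lam (Graft i a b)) = ln (inv_divisors lam a) + ln (inv_divisors lam b) + ln (1 / \<epsilon>)"
    using Graft e0 by (simp add: \<epsilon>_def[symmetric] ln_mult ln_div)
  also note ln_inverse_le_level_sum[of T K \<epsilon>, OF T eps]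
  finally show ?case using Graft e0 d2
    by (simp add: \<epsilon>_def[symmetric] algebra_simps sum.distrib)
qed

text \<open>
  The hypothesis on \<open>T v\<close> has the factor 2 because two small divisors on one branch produce a third
  one: \<open>\<lambda>\<^bsup>\<alpha>+e\<^sub>j\<^esup> - \<lambda>\<^sub>i = (\<lambda>\<^bsup>\<alpha>+\<beta>\<^esup> - \<lambda>\<^sub>i) - \<lambda>\<^sup>\<alpha> (\<lambda>\<^sup>\<beta> - \<lambda>\<^sub>j)\<close>.  If \<open>2 |\<alpha>| < p v\<close>, then the left-hand side has an
  exponent of degree below \<open>p v\<close> and is at least \<open>2 T v\<close>, so that the divisors on the right
  are not both smaller than \<open>T v\<close>.  Hence the counting lemma applies with \<open>p = p v\<close>.
\<close>

lemma inv_divisors_le: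
  fixes T :: "nat \<Rightarrow> real" and p :: "nat \<Rightarrow> nat" and lam :: "complex ^ 'n::finite"
  assumes unit: "\<And>i. cmod (lam $ i) = 1"
    and T: "\<And>v. 0 < T v" "\<And>v. T v \<le> 1" and p: "\<And>v. 1 \<le> p v"
    and low: "\<And>v \<gamma> i. 2 \<le> mdeg \<gamma> \<Longrightarrow> mdeg \<gamma> < p v \<Longrightarrow> 2 * T v \<le> cmod (mpow lam \<gamma> - lam $ i)"
    and d: "mdeg (idx t) < p (Suc K)"
  shows "0 < inv_divisors lam t"
    and "inv_divisors lam t \<le> exp (mdeg (idx t) * (ln (1 / T 0) + 2 * (\<Sum>v\<le>K. ln (1 / T (Suc v)) / p v)))"
proof -
  let ?S = "\<lambda>v \<gamma> i. 2 \<le> mdeg \<gamma> \<and> cmod (mpow lam \<gamma> - lam $ i) < T v"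
  let ?d = "mdeg (idx t)"
  have low1: "T v \<le> cmod (mpow lam \<gamma> - lam $ i)" if "2 \<le> mdeg \<gamma>" "mdeg \<gamma> < p v" for v \<gamma> i
    using low[OF that, of i] T(1)[of v] by linarith
  have L: "ln (1 / T v) \<ge> 0" for v using T by (simp add: ln_div)
  have mp: "cmod (mpow lam \<alpha>) = 1" for \<alpha>
    by (simp add: mpow_def prod_norm[symmetric] norm_power unit)
  have mpow_add: "mpow lam (\<alpha> + \<beta>) = mpow lam \<alpha> * mpow lam \<beta>" for \<alpha> \<beta>
    by (simp add: mpow_def power_add prod.distrib)
  have count: "graft_count (?S v) t \<le> 2 * ?d / p v" for v
  proof -
    have "real (graft_count (?S v) t) \<le> max 0 (2 * ?d / p v - 1)"
    proof (rule graft_count_le[OF p])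
      show "p v \<le> mdeg \<alpha>" if "?S v \<alpha> i" for \<alpha> i
        using that low1[of \<alpha> v i] by force
      show "p v \<le> 2 * mdeg \<alpha>" if s: "?S v (\<alpha> + \<beta>) i" "?S v \<beta> j" "\<alpha> \<noteq> 0" for \<alpha> \<beta> i j
      proof (rule ccontr)
        assume *: "\<not> p v \<le> 2 * mdeg \<alpha>"
        have a1: "mdeg \<alpha> \<ge> 1" using s(3) by (metis less_one linorder_not_less mdeg_eq_0_iff)
        have "2 * T v \<le> cmod (mpow lam (\<alpha> + axis j 1) - lam $ i)"
          using * a1 by (intro low) (auto simp del: One_nat_def)
        also have "mpow lam (\<alpha> + axis j 1) - lam $ i =
            (mpow lam (\<alpha> + \<beta>) - lam $ i) - mpow lam \<alpha> * (mpow lam \<beta> - lam $ j)"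
          by (simp add: mpow_add mpow_axis algebra_simps del: One_nat_def)
        also have "cmod \<dots> \<le> cmod (mpow lam (\<alpha> + \<beta>) - lam $ i) + cmod (mpow lam \<beta> - lam $ j)"
          by (rule order_trans[OF norm_triangle_ineq4]) (simp add: norm_mult mp)
        also have "\<dots> < 2 * T v" using s by simp
        finally show False by simp
      qed
    qed
    also have "\<dots> \<le> 2 * ?d / p v" using p[of v] by simp
    finally show ?thesis .
  qed
  note * = ln_inv_divisors_le_counts[of T "?d" K lam t, OF T low1 order_refl]
  show pos: "0 < inv_divisors lam t" using * d by auto
  have "ln (inv_divisors lam t) \<le> graft_count (\<lambda>_ _. True) t * ln (1 / T 0) +
     (\<Sum>v\<le>K. graft_count (?S v) t * ln (1 / T (Suc v)))" using * d by auto
  also have "\<dots> \<le> ?d * ln (1 / T 0) + (\<Sum>v\<le>K. 2 * ?d / p v * ln (1 / T (Suc v)))"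
    using L count graft_count_less_mdeg[of "\<lambda>_ _. True" t]
    by (intro add_mono sum_mono mult_right_mono) auto
  also have "\<dots> = ?d * (ln (1 / T 0) + 2 * (\<Sum>v\<le>K. ln (1 / T (Suc v)) / p v))"
    by (simp add: algebra_simps sum_distrib_left)
  finally show "inv_divisors lam t \<le> exp (?d * (ln (1 / T 0) + 2 * (\<Sum>v\<le>K. ln (1 / T (Suc v)) / p v)))"
    using pos by (metis exp_le_cancel_iff exp_ln)
qed

section \<open>The majorant method relative to forest weights\<close>

definition forest_weight :: "complex ^ 'n \<Rightarrow> (nat \<Rightarrow> real) \<Rightarrow> 'n::finite forest \<Rightarrow> real" where
  "forest_weight lam M t = inv_divisors lam t * arity_weight M t"

text \<open>
  For a given arity and index there are only finitely many forests.  Inserting \<open>0\<close> gives a value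
  when there is none.  Arity \<open>0\<close> belongs to the empty product, for which no forest exists, and is
  given the value that keeps \<open>max_weight\<close> supermultiplicative.
\<close>

definition max_weight :: "complex ^ 'n \<Rightarrow> (nat \<Rightarrow> real) \<Rightarrow> nat \<Rightarrow> nat ^ 'n::finite \<Rightarrow> real" where
  "max_weight lam M k \<alpha> = (if k = 0 then of_bool (\<alpha> = 0)
     else Max (insert 0 (forest_weight lam M ` {t. arity t = k \<and> idx t = \<alpha>})))"

lemma finite_forests_idx: "finite {t :: 'n::finite forest. arity t = k \<and> idx t = \<alpha>}"
  by (rule finite_subset[OF _ finite_forests[of "mdeg \<alpha>"]]) auto

lemma max_weight_nonneg: "0 \<le> max_weight lam M k \<alpha>"
  using finite_forests_idx[of k \<alpha>] by (simp add: max_weight_def Max_ge_iff)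

lemma forest_weight_le_max: "forest_weight lam M t \<le> max_weight lam M (arity t) (idx t)"
proof -
  have "arity t \<noteq> 0" using arity_pos[of t] by simp
  then show ?thesis
    using finite_forests_idx[of "arity t" "idx t"] by (auto simp: max_weight_def intro!: Max_ge)
qed

lemma max_weight_cases:
  assumes "k \<noteq> 0"
  obtains "max_weight lam M k \<alpha> = 0"
  | t where "arity t = k" "idx t = \<alpha>" "max_weight lam M k \<alpha> = forest_weight lam M t"
proof -
  let ?X = "insert 0 (forest_weight lam M ` {t. arity t = k \<and> idx t = \<alpha>})"
  have "Max ?X \<in> ?X" using finite_forests_idx[of k \<alpha>] by (intro Max_in) auto
  then show ?thesis using assms that by (auto simp: max_weight_def)
qed

lemma max_weight_mult_le:
  "max_weight lam M k \<alpha> * max_weight lam M l \<beta> \<le> max_weight lam M (k + l) (\<alpha> + \<beta>)"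
proof (cases "k = 0 \<or> l = 0")
  case True
  have "max_weight lam M 0 \<gamma> = of_bool (\<gamma> = 0)" for \<gamma> :: "nat ^ 'a" by (simp add: max_weight_def)
  with True show ?thesis by (auto simp: max_weight_nonneg)
next
  case False
  then have kl: "k \<noteq> 0" "l \<noteq> 0" by auto
  note nonneg = max_weight_nonneg[of lam M "k + l" "\<alpha> + \<beta>"]
  show ?thesis
  proof (rule max_weight_cases[OF kl(1), of lam M \<alpha>]; rule max_weight_cases[OF kl(2), of lam M \<beta>])
    fix t u
    assume *: "arity t = k" "idx t = \<alpha>" "max_weight lam M k \<alpha> = forest_weight lam M t"
      "arity u = l" "idx u = \<beta>" "max_weight lam M l \<beta> = forest_weight lam M u"
    then have "max_weight lam M k \<alpha> * max_weight lam M l \<beta> = forest_weight lam M (Join t u)"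
      by (simp add: forest_weight_def)
    also have "\<dots> \<le> max_weight lam M (k + l) (\<alpha> + \<beta>)"
      using forest_weight_le_max[of lam M "Join t u"] * by simp
    finally show ?thesis .
  qed (use nonneg in auto)
qed

text \<open>
  A forest of arity at least 2 is a join, so a graft can be put on top of it.  This cancels the
  divisor in the recursion for the linearization.
\<close>

lemma max_weight_graft_le:
  assumes k: "2 \<le> k" and nz: "mpow lam \<alpha> - lam $ i \<noteq> 0"
  shows "M k * max_weight lam M k \<alpha> \<le> cmod (mpow lam \<alpha> - lam $ i) * max_weight lam M 1 \<alpha>"
proof -
  have k0: "k \<noteq> 0" using k by simp
  show ?thesis
  proof (rule max_weight_cases[OF k0, of lam M \<alpha>])
    fix t assume t: "arity t = k" "idx t = \<alpha>" "max_weight lam M k \<alpha> = forest_weight lam M t"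
    then obtain a b where ab: "t = Join a b" using k by (cases t) auto
    have "M k * max_weight lam M k \<alpha> =
        cmod (mpow lam \<alpha> - lam $ i) * forest_weight lam M (Graft i a b)"
      using t nz by (simp add: ab forest_weight_def)
    also have "\<dots> \<le> cmod (mpow lam \<alpha> - lam $ i) * max_weight lam M 1 \<alpha>"
      using forest_weight_le_max[of lam M "Graft i a b"] t by (intro mult_left_mono) (auto simp: ab)
    finally show ?thesis .
  qed (use max_weight_nonneg[of lam M 1 \<alpha>] in simp)
qed

text \<open>
  The majorant method with the small divisors factored out: up to degree \<open>D\<close> the coefficients of
  \<open>P\<close> are bounded by forest weights of arity \<open>k\<close> times those of a polynomial with nonnegative
  coefficients, whose value at \<open>(\<tau>, \<dots>, \<tau>)\<close> is at most \<open>x\<close>.  The bound \<open>x\<close> behaves like a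
  seminorm that is submultiplicative because the maximal weights are supermultiplicative.
\<close>

definition majorized ::
  "complex ^ 'n \<Rightarrow> (nat \<Rightarrow> real) \<Rightarrow> real \<Rightarrow> nat \<Rightarrow> nat \<Rightarrow> 'n::finite mfps \<Rightarrow> real \<Rightarrow> bool" where
  "majorized lam M \<tau> D k P x \<longleftrightarrow> (\<exists>s. (\<forall>\<alpha>. 0 \<le> s \<alpha>) \<and>
     (\<forall>\<alpha>. mdeg \<alpha> \<le> D \<longrightarrow> cmod (mcoeff P \<alpha>) \<le> s \<alpha> * max_weight lam M k \<alpha>) \<and>
     (\<Sum>\<alpha> | mdeg \<alpha> \<le> D. s \<alpha> * \<tau> ^ mdeg \<alpha>) \<le> x)"

lemma majorized_mono: "majorized lam M \<tau> D k P x \<Longrightarrow> x \<le> y \<Longrightarrow> majorized lam M \<tau> D k P y"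
  unfolding majorized_def by (meson order_trans)

lemma majorized_one: "majorized lam M \<tau> D 0 1 1"
  unfolding majorized_def
proof (intro exI[of _ "\<lambda>\<alpha>. of_bool (\<alpha> = 0)"] conjI)
  have "(\<Sum>\<alpha>::nat^'a | mdeg \<alpha> \<le> D. of_bool (\<alpha> = 0) * \<tau> ^ mdeg \<alpha>) =
     (\<Sum>\<alpha>::nat^'a | mdeg \<alpha> \<le> D. if \<alpha> = 0 then 1 else 0)"
    by (rule sum.cong) auto
  then show "(\<Sum>\<alpha>::nat^'a | mdeg \<alpha> \<le> D. of_bool (\<alpha> = 0) * \<tau> ^ mdeg \<alpha>) \<le> 1" by simp
qed (auto simp: mcoeff_one max_weight_def)

lemma majorized_mult:
  assumes \<tau>: "0 \<le> \<tau>" and "majorized lam M \<tau> D k P x" "majorized lam M \<tau> D l Q y"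
  shows "majorized lam M \<tau> D (k + l) (P * Q) (x * y)"
proof -
  let ?w = "max_weight lam M"
  obtain r where r: "\<And>\<alpha>. 0 \<le> r \<alpha>" "\<And>\<alpha>. mdeg \<alpha> \<le> D \<Longrightarrow> cmod (mcoeff P \<alpha>) \<le> r \<alpha> * ?w k \<alpha>"
    "(\<Sum>\<alpha> | mdeg \<alpha> \<le> D. r \<alpha> * \<tau> ^ mdeg \<alpha>) \<le> x"
    using assms(2) by (auto simp: majorized_def)
  obtain s where s: "\<And>\<alpha>. 0 \<le> s \<alpha>" "\<And>\<alpha>. mdeg \<alpha> \<le> D \<Longrightarrow> cmod (mcoeff Q \<alpha>) \<le> s \<alpha> * ?w l \<alpha>"
    "(\<Sum>\<alpha> | mdeg \<alpha> \<le> D. s \<alpha> * \<tau> ^ mdeg \<alpha>) \<le> y"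
    using assms(3) by (auto simp: majorized_def)
  let ?D = "{\<alpha> :: nat ^ 'a. mdeg \<alpha> \<le> D}"
  show ?thesis
    unfolding majorized_def
  proof (intro exI[of _ "\<lambda>\<alpha>. \<Sum>(\<beta>, \<gamma>)\<in>msplits \<alpha>. r \<beta> * s \<gamma>"] conjI allI impI)
    fix \<alpha> :: "nat ^ 'a"
    show "0 \<le> (\<Sum>(\<beta>, \<gamma>)\<in>msplits \<alpha>. r \<beta> * s \<gamma>)" by (intro sum_nonneg) (auto simp: r s)
    assume \<alpha>: "mdeg \<alpha> \<le> D"
    have "cmod (mcoeff P \<beta>) * cmod (mcoeff Q \<gamma>) \<le> r \<beta> * s \<gamma> * ?w (k + l) \<alpha>"
      if "(\<beta>, \<gamma>) \<in> msplits \<alpha>" for \<beta> \<gamma>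
    proof -
      have split: "\<alpha> = \<beta> + \<gamma>" using that by (simp add: msplits_def)
      have "cmod (mcoeff P \<beta>) * cmod (mcoeff Q \<gamma>) \<le> (r \<beta> * ?w k \<beta>) * (s \<gamma> * ?w l \<gamma>)"
        using \<alpha> r(1,2) s(1,2) max_weight_nonneg[of lam M]
        by (intro mult_mono) (auto simp: split)
      also have "\<dots> = r \<beta> * s \<gamma> * (?w k \<beta> * ?w l \<gamma>)" by simp
      also have "\<dots> \<le> r \<beta> * s \<gamma> * ?w (k + l) \<alpha>"
        unfolding split by (intro mult_left_mono max_weight_mult_le) (simp add: r s)
      finally show ?thesis .
    qed
    then have "(\<Sum>(\<beta>, \<gamma>)\<in>msplits \<alpha>. cmod (mcoeff P \<beta> * mcoeff Q \<gamma>)) \<le>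
        (\<Sum>(\<beta>, \<gamma>)\<in>msplits \<alpha>. r \<beta> * s \<gamma> * ?w (k + l) \<alpha>)"
      by (intro sum_mono) (auto simp: norm_mult)
    then show "cmod (mcoeff (P * Q) \<alpha>) \<le> (\<Sum>(\<beta>, \<gamma>)\<in>msplits \<alpha>. r \<beta> * s \<gamma>) * ?w (k + l) \<alpha>"
      unfolding mcoeff_mult sum_distrib_right case_prod_unfold
      by (intro order_trans[OF norm_sum]) (auto simp: case_prod_unfold)
  next
    have "(\<Sum>\<alpha>\<in>?D. (\<Sum>(\<beta>, \<gamma>)\<in>msplits \<alpha>. r \<beta> * s \<gamma>) * \<tau> ^ mdeg \<alpha>) =
       (\<Sum>\<alpha>\<in>?D. \<Sum>q\<in>msplits \<alpha>. (r (fst q) * s (snd q)) * \<tau> ^ mdeg \<alpha>)"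
      by (simp add: sum_distrib_right case_prod_unfold)
    also have "\<dots> = (\<Sum>(\<alpha>, q)\<in>Sigma ?D msplits. (r (fst q) * s (snd q)) * \<tau> ^ mdeg \<alpha>)"
      by (rule sum.Sigma) auto
    also have "\<dots> = (\<Sum>q\<in>{q. mdeg (fst q + snd q) \<le> D}. (r (fst q) * \<tau> ^ mdeg (fst q)) * (s (snd q) * \<tau> ^ mdeg (snd q)))"
      by (rule sum.reindex_bij_witness[of _ "\<lambda>q. (fst q + snd q, q)" snd])
        (auto simp: msplits_def power_add)
    also have "\<dots> \<le> (\<Sum>q\<in>?D \<times> ?D. (r (fst q) * \<tau> ^ mdeg (fst q)) * (s (snd q) * \<tau> ^ mdeg (snd q)))"
      by (rule sum_mono2) (auto simp: r s \<tau>)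
    also have "\<dots> = (\<Sum>\<alpha>\<in>?D. r \<alpha> * \<tau> ^ mdeg \<alpha>) * (\<Sum>\<alpha>\<in>?D. s \<alpha> * \<tau> ^ mdeg \<alpha>)"
      by (simp add: sum_product sum.cartesian_product case_prod_unfold)
    also have "\<dots> \<le> x * y"
      using r s \<tau> by (intro mult_mono sum_nonneg order_trans[OF sum_nonneg r(3)]) auto
    finally show "(\<Sum>\<alpha>\<in>?D. (\<Sum>(\<beta>, \<gamma>)\<in>msplits \<alpha>. r \<beta> * s \<gamma>) * \<tau> ^ mdeg \<alpha>) \<le> x * y" .
  qed
qed

lemma majorized_mono_at:
  assumes \<tau>: "0 \<le> \<tau>" and G: "\<And>i. majorized lam M \<tau> D 1 (G $ i) x"
  shows "majorized lam M \<tau> D (mdeg \<alpha>) (mono_at G \<alpha>) (x ^ mdeg \<alpha>)"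
proof -
  have pow: "majorized lam M \<tau> D k ((G $ i) ^ k) (x ^ k)" for i k
  proof (induction k)
    case (Suc k)
    then show ?case using majorized_mult[OF \<tau> G[of i] Suc] by simp
  qed (simp add: majorized_one)
  have "majorized lam M \<tau> D (\<Sum>i\<in>S. \<alpha> $ i) (\<Prod>i\<in>S. (G $ i) ^ (\<alpha> $ i)) (x ^ (\<Sum>i\<in>S. \<alpha> $ i))"
    if "finite S" for S
    using that by (induction S) (auto simp: majorized_one power_add intro!: majorized_mult \<tau> pow)
  then show ?thesis by (simp add: mdeg_def mono_at_def)
qed

text \<open>
  The sum over all multi-indices is the \<open>n\<close>-th power of the geometric series with sum 2.
\<close>

lemma sum_half_power_mdeg_le:
  "(\<Sum>\<alpha> :: nat ^ 'n::finite | mdeg \<alpha> \<le> D. (1 / 2 :: real) ^ mdeg \<alpha>) \<le> 2 ^ CARD('n)"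
proof -
  let ?D = "{\<alpha> :: nat ^ 'n. mdeg \<alpha> \<le> D}"
  have inj: "inj_on vec_nth ?D" by (auto simp: inj_on_def vec_nth_inject)
  have sub: "vec_nth ` ?D \<subseteq> (\<Pi>\<^sub>E i\<in>UNIV. {..D})"
    by (auto simp: mdeg_def) (meson finite_code iso_tuple_UNIV_I member_le_sum order_trans zero_le)
  have geo: "(\<Sum>k\<le>D. (1 / 2 :: real) ^ k) \<le> 2"
    using sum_le_suminf[of "\<lambda>k. (1 / 2 :: real) ^ k" "{..D}"] suminf_geometric[of "1 / 2 :: real"] by simp
  have "(\<Sum>\<alpha>\<in>?D. (1 / 2 :: real) ^ mdeg \<alpha>) = (\<Sum>g\<in>vec_nth ` ?D. \<Prod>i\<in>UNIV. (1 / 2) ^ g i)"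
    by (subst sum.reindex[OF inj]) (simp add: mdeg_def power_sum)
  also have "\<dots> \<le> (\<Sum>g\<in>(\<Pi>\<^sub>E i\<in>(UNIV :: 'n set). {..D}). \<Prod>i\<in>UNIV. (1 / 2) ^ g i)"
    using sub by (intro sum_mono2 finite_PiE) (auto intro!: prod_nonneg)
  also have "\<dots> = (\<Prod>i\<in>(UNIV :: 'n set). \<Sum>k\<le>D. (1 / 2) ^ k)"
    by (rule prod_sum_PiE[symmetric]) auto
  also have "\<dots> \<le> (\<Prod>i\<in>(UNIV :: 'n set). 2)"
    using geo by (intro prod_mono) (auto intro!: sum_nonneg)
  finally show ?thesis by simp
qed

lemma sum_power_mdeg_ge_2_le:
  fixes y :: real
  assumes "0 \<le> y" "2 * y \<le> 1"
  shows "(\<Sum>\<alpha> :: nat ^ 'n::finite | 2 \<le> mdeg \<alpha> \<and> mdeg \<alpha> \<le> D. y ^ mdeg \<alpha>) \<le> 2 ^ CARD('n) * (2 * y)\<^sup>2"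
proof -
  let ?E = "{\<alpha> :: nat ^ 'n. 2 \<le> mdeg \<alpha> \<and> mdeg \<alpha> \<le> D}"
  have "(\<Sum>\<alpha>\<in>?E. y ^ mdeg \<alpha>) \<le> (\<Sum>\<alpha>\<in>?E. (2 * y)\<^sup>2 * (1 / 2) ^ mdeg \<alpha>)"
  proof (rule sum_mono)
    fix \<alpha> :: "nat ^ 'n" assume "\<alpha> \<in> ?E"
    then have "(2 * y) ^ mdeg \<alpha> \<le> (2 * y)\<^sup>2" using assms by (intro power_decreasing) auto
    then have "(2 * y) ^ mdeg \<alpha> * (1 / 2) ^ mdeg \<alpha> \<le> (2 * y)\<^sup>2 * (1 / 2) ^ mdeg \<alpha>"
      by (intro mult_right_mono) auto
    then show "y ^ mdeg \<alpha> \<le> (2 * y)\<^sup>2 * (1 / 2) ^ mdeg \<alpha>"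
      by (subst (asm) power_mult_distrib[symmetric]) simp
  qed
  also have "\<dots> = (2 * y)\<^sup>2 * (\<Sum>\<alpha>\<in>?E. (1 / 2) ^ mdeg \<alpha>)" by (simp add: sum_distrib_left)
  also have "\<dots> \<le> (2 * y)\<^sup>2 * (\<Sum>\<alpha> :: nat ^ 'n | mdeg \<alpha> \<le> D. (1 / 2) ^ mdeg \<alpha>)"
    by (intro mult_left_mono sum_mono2) auto
  also have "\<dots> \<le> (2 * y)\<^sup>2 * 2 ^ CARD('n)"
    by (intro mult_left_mono sum_half_power_mdeg_le) auto
  finally show ?thesis by (simp add: mult.commute)
qed

lemma max_weight_axis: "max_weight lam M 1 (axis i 1) \<ge> 1"
  using forest_weight_le_max[of lam M "Leaf i"] by (simp add: forest_weight_def)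

lemma majorized_id:
  assumes "0 \<le> \<tau>"
  shows "majorized lam M \<tau> D 1 (id_series $ i) \<tau>"
  unfolding majorized_def
proof (intro exI[of _ "\<lambda>\<alpha>. of_bool (\<alpha> = axis i 1)"] conjI allI impI)
  have "(\<Sum>\<alpha> | mdeg \<alpha> \<le> D. of_bool (\<alpha> = axis i 1) * \<tau> ^ mdeg \<alpha>) =
     (\<Sum>\<alpha> | mdeg \<alpha> \<le> D. if \<alpha> = axis i 1 then \<tau> else 0)"
    by (rule sum.cong) (auto simp: mdeg_axis simp del: One_nat_def)
  then show "(\<Sum>\<alpha> | mdeg \<alpha> \<le> D. of_bool (\<alpha> = axis i 1) * \<tau> ^ mdeg \<alpha>) \<le> \<tau>"
    using assms by (simp del: One_nat_def)
qed (use max_weight_axis[of lam M i] in \<open>auto simp: mcoeff_id_series simp del: One_nat_def\<close>)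

text \<open>
  Relative to the weights the divisors have disappeared, and one step of the iteration obeys the
  scalar estimate \<open>x \<mapsto> \<tau> + O(x\<^sup>2)\<close>, where \<open>\<tau>\<close> comes from the linear part.  So a bound \<open>x\<close> of the order of
  \<open>\<tau>\<close> is preserved once \<open>\<tau>\<close> is small.
\<close>

lemma majorized_lin_step:
  fixes f :: "'n::finite vfps"
  assumes nonres: "\<not> resonant lam" and f: "f \<in> V 1"
    and fle: "\<And>i \<alpha>. 2 \<le> mdeg \<alpha> \<Longrightarrow> cmod (mcoeff (f $ i) \<alpha>) \<le> A * B ^ mdeg \<alpha> * M (mdeg \<alpha>)"
    and A: "0 \<le> A" and B: "0 \<le> B" and \<tau>: "0 \<le> \<tau>" and small: "2 * (B * x) \<le> 1" "\<tau> + A * (2 ^ CARD('n) * (2 * (B * x))\<^sup>2) \<le> x"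
    and G: "\<And>i. majorized lam M \<tau> D 1 (G $ i) x"
  shows "majorized lam M \<tau> D 1 (lin_step lam f G $ i) x"
proof -
  let ?w = "max_weight lam M"
  let ?E = "{\<alpha> :: nat ^ 'n. 2 \<le> mdeg \<alpha> \<and> mdeg \<alpha> \<le> D}"
  have fin: "finite ?E" by (rule finite_subset[OF _ finite_mdeg_le[of D]]) auto
  have x: "0 \<le> x" using small(2) \<tau> A by (smt (verit) mult_nonneg_nonneg zero_le_power2 zero_le_power)
  have "\<exists>s. (\<forall>\<beta>. 0 \<le> s \<beta>) \<and>
     (\<forall>\<beta>. mdeg \<beta> \<le> D \<longrightarrow> cmod (mcoeff (mono_at G \<alpha>) \<beta>) \<le> s \<beta> * ?w (mdeg \<alpha>) \<beta>) \<and>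
     (\<Sum>\<beta> | mdeg \<beta> \<le> D. s \<beta> * \<tau> ^ mdeg \<beta>) \<le> x ^ mdeg \<alpha>" for \<alpha>
    using majorized_mono_at[OF \<tau> G, of \<alpha>] unfolding majorized_def .
  then obtain s where s': "\<And>\<alpha>. (\<forall>\<beta>. 0 \<le> s \<alpha> \<beta>) \<and>
     (\<forall>\<beta>. mdeg \<beta> \<le> D \<longrightarrow> cmod (mcoeff (mono_at G \<alpha>) \<beta>) \<le> s \<alpha> \<beta> * ?w (mdeg \<alpha>) \<beta>) \<and>
     (\<Sum>\<beta> | mdeg \<beta> \<le> D. s \<alpha> \<beta> * \<tau> ^ mdeg \<beta>) \<le> x ^ mdeg \<alpha>"
    by moura
  then have s: "\<And>\<alpha> \<beta>. 0 \<le> s \<alpha> \<beta>"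
    "\<And>\<alpha> \<beta>. mdeg \<beta> \<le> D \<Longrightarrow> cmod (mcoeff (mono_at G \<alpha>) \<beta>) \<le> s \<alpha> \<beta> * ?w (mdeg \<alpha>) \<beta>"
    "\<And>\<alpha>. (\<Sum>\<beta> | mdeg \<beta> \<le> D. s \<alpha> \<beta> * \<tau> ^ mdeg \<beta>) \<le> x ^ mdeg \<alpha>"
    by blast+
  have "majorized lam M \<tau> D 1 (id_series $ i) \<tau>" by (rule majorized_id[OF \<tau>])
  then obtain e where e: "\<And>\<beta>. 0 \<le> e \<beta>"
    "\<And>\<beta>. mdeg \<beta> \<le> D \<Longrightarrow> cmod (mcoeff (id_series $ i) \<beta>) \<le> e \<beta> * ?w 1 \<beta>"
    "(\<Sum>\<beta> | mdeg \<beta> \<le> D. e \<beta> * \<tau> ^ mdeg \<beta>) \<le> \<tau>"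
    unfolding majorized_def by auto
  define S where "S \<beta> = (\<Sum>\<alpha>\<in>?E. A * B ^ mdeg \<alpha> * s \<alpha> \<beta>)" for \<beta>
  have S0: "0 \<le> S \<beta>" for \<beta> unfolding S_def by (intro sum_nonneg) (simp add: A B s)
  show ?thesis
    unfolding majorized_def
  proof (intro exI[of _ "\<lambda>\<beta>. e \<beta> + S \<beta>"] conjI allI impI)
    fix \<beta> :: "nat ^ 'n"
    show "0 \<le> e \<beta> + S \<beta>" using e S0 by simp
    assume D: "mdeg \<beta> \<le> D"
    show "cmod (mcoeff (lin_step lam f G $ i) \<beta>) \<le> (e \<beta> + S \<beta>) * ?w 1 \<beta>"
    proof (cases "mdeg \<beta> \<le> 1")
      case True
      then have "cmod (mcoeff (lin_step lam f G $ i) \<beta>) \<le> e \<beta> * ?w 1 \<beta>"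
        using e(2)[OF D] by (simp add: mcoeff_lin_step)
      also have "\<dots> \<le> (e \<beta> + S \<beta>) * ?w 1 \<beta>"
        by (intro mult_right_mono max_weight_nonneg) (simp add: S0)
      finally show ?thesis .
    next
      case False
      let ?\<epsilon> = "cmod (mpow lam \<beta> - lam $ i)"
      have nz: "mpow lam \<beta> - lam $ i \<noteq> 0" using nonres False by (auto simp: resonant_def)
      have summand: "cmod (mcoeff (f $ i) \<alpha> * mcoeff (mono_at G \<alpha>) \<beta>) \<le> A * B ^ mdeg \<alpha> * s \<alpha> \<beta> * (?\<epsilon> * ?w 1 \<beta>)"
        if "2 \<le> mdeg \<alpha>" for \<alpha>
      proof -
        have "cmod (mcoeff (f $ i) \<alpha> * mcoeff (mono_at G \<alpha>) \<beta>) \<le>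
            (A * B ^ mdeg \<alpha> * M (mdeg \<alpha>)) * (s \<alpha> \<beta> * ?w (mdeg \<alpha>) \<beta>)"
          unfolding norm_mult using fle[OF that, of i]
          by (intro mult_mono s(2) D fle that) (auto intro: order_trans[OF norm_ge_zero])
        also have "\<dots> = (A * B ^ mdeg \<alpha> * s \<alpha> \<beta>) * (M (mdeg \<alpha>) * ?w (mdeg \<alpha>) \<beta>)" by simp
        also have "\<dots> \<le> (A * B ^ mdeg \<alpha> * s \<alpha> \<beta>) * (?\<epsilon> * ?w 1 \<beta>)"
          by (intro mult_left_mono max_weight_graft_le that nz) (simp add: A B s)
        finally show ?thesis .
      qed
      have "mcoeff (mfps_compose (f $ i) G) \<beta> =
          (\<Sum>\<alpha> | 2 \<le> mdeg \<alpha> \<and> mdeg \<alpha> \<le> mdeg \<beta>. mcoeff (f $ i) \<alpha> * mcoeff (mono_at G \<alpha>) \<beta>)"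
        unfolding mcoeff_compose using f
        by (intro sum.mono_neutral_right finite_mdeg_le) (auto simp: V_iff ord_ge_def numeral_2_eq_2 not_less[symmetric])
      then have "cmod (mcoeff (mfps_compose (f $ i) G) \<beta>) \<le>
          (\<Sum>\<alpha> | 2 \<le> mdeg \<alpha> \<and> mdeg \<alpha> \<le> mdeg \<beta>. A * B ^ mdeg \<alpha> * s \<alpha> \<beta> * (?\<epsilon> * ?w 1 \<beta>))"
        by (simp only:) (rule order_trans[OF norm_sum], rule sum_mono, rule summand, simp)
      also have "\<dots> \<le> (\<Sum>\<alpha>\<in>?E. A * B ^ mdeg \<alpha> * s \<alpha> \<beta> * (?\<epsilon> * ?w 1 \<beta>))"
        using D A B s(1) max_weight_nonneg[of lam M 1 \<beta>] by (intro sum_mono2 fin) auto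
      also have "\<dots> = ?\<epsilon> * (S \<beta> * ?w 1 \<beta>)" by (simp add: S_def sum_distrib_right sum_distrib_left mult_ac)
      finally have "cmod (mcoeff (lin_step lam f G $ i) \<beta>) \<le> S \<beta> * ?w 1 \<beta>"
        using False nz by (simp add: mcoeff_lin_step norm_divide field_simps)
      also have "\<dots> \<le> (e \<beta> + S \<beta>) * ?w 1 \<beta>"
        by (intro mult_right_mono max_weight_nonneg) (simp add: e)
      finally show ?thesis .
    qed
  next
    have "(\<Sum>\<beta> | mdeg \<beta> \<le> D. S \<beta> * \<tau> ^ mdeg \<beta>) =
        (\<Sum>\<alpha>\<in>?E. A * B ^ mdeg \<alpha> * (\<Sum>\<beta> | mdeg \<beta> \<le> D. s \<alpha> \<beta> * \<tau> ^ mdeg \<beta>))"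
      unfolding S_def sum_distrib_right sum_distrib_left by (subst sum.swap) (simp add: mult_ac)
    also have "\<dots> \<le> (\<Sum>\<alpha>\<in>?E. A * B ^ mdeg \<alpha> * x ^ mdeg \<alpha>)"
      by (intro sum_mono mult_left_mono s) (simp add: A B)
    also have "\<dots> = A * (\<Sum>\<alpha>\<in>?E. (B * x) ^ mdeg \<alpha>)"
      by (simp add: sum_distrib_left power_mult_distrib mult_ac)
    also have "\<dots> \<le> A * (2 ^ CARD('n) * (2 * (B * x))\<^sup>2)"
      using B x small by (intro mult_left_mono A sum_power_mdeg_ge_2_le) auto
    finally have "(\<Sum>\<beta> | mdeg \<beta> \<le> D. S \<beta> * \<tau> ^ mdeg \<beta>) \<le> A * (2 ^ CARD('n) * (2 * (B * x))\<^sup>2)" .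
    then show "(\<Sum>\<beta> | mdeg \<beta> \<le> D. (e \<beta> + S \<beta>) * \<tau> ^ mdeg \<beta>) \<le> x"
      using e(3) small(2) by (simp add: distrib_right sum.distrib)
  qed
qed

text \<open>
  The linearization agrees to degree \<open>n\<close> with the \<open>n\<close>-th iterate of \<open>lin_step\<close> on the identity,
  and all iterates are majorized with the same \<open>x = 2 \<tau>\<close>.
\<close>

lemma linearization_majorized:
  fixes f :: "'n::finite vfps"
  assumes nonres: "\<not> resonant lam" and f: "f \<in> V 1" and H: "H = lin_step lam f H"
    and fle: "\<And>i \<alpha>. 2 \<le> mdeg \<alpha> \<Longrightarrow> cmod (mcoeff (f $ i) \<alpha>) \<le> A * B ^ mdeg \<alpha> * M (mdeg \<alpha>)"
    and A: "0 \<le> A" and B: "0 \<le> B"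
  obtains A' B' where "0 < A'" "0 < B'"
    "\<And>i \<alpha>. cmod (mcoeff (H $ i) \<alpha>) \<le> A' * B' ^ mdeg \<alpha> * max_weight lam M 1 \<alpha>"
proof -
  \<comment> \<open>\<open>c \<ge> 4 B\<close> and \<open>c \<ge> 16 A 2\<^sup>n B\<^sup>2\<close> make \<open>\<tau> = 1 / c\<close> satisfy the two smallness
    conditions of one step for \<open>x = 2 \<tau>\<close>.\<close>
  define c where "c = 4 * B + 16 * A * 2 ^ CARD('n) * B\<^sup>2 + 1"
  define \<tau> where "\<tau> = 1 / c"
  have c: "c \<ge> 1" using A B by (simp add: c_def)
  then have \<tau>: "0 < \<tau>" and c\<tau>: "c * \<tau> = 1" by (auto simp: \<tau>_def)
  have "4 * B * \<tau> \<le> c * \<tau>" "16 * A * 2 ^ CARD('n) * B\<^sup>2 * \<tau> \<le> c * \<tau>"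
    using \<tau> A B by (auto intro!: mult_right_mono simp: c_def)
  then have small: "2 * (B * (2 * \<tau>)) \<le> 1" and *: "16 * A * 2 ^ CARD('n) * B\<^sup>2 * \<tau> \<le> 1"
    using c\<tau> by auto
  have "\<tau> * (16 * A * 2 ^ CARD('n) * B\<^sup>2 * \<tau>) \<le> \<tau> * 1" by (rule mult_left_mono[OF *]) (use \<tau> in simp)
  then have small2: "\<tau> + A * (2 ^ CARD('n) * (2 * (B * (2 * \<tau>)))\<^sup>2) \<le> 2 * \<tau>"
    by (simp add: power2_eq_square algebra_simps)
  define G where "G n = (lin_step lam f ^^ n) id_series" for n
  have maj: "majorized lam M \<tau> D 1 (G n $ i) (2 * \<tau>)" for D n i
  proof (induction n arbitrary: i)
    case 0
    have "majorized lam M \<tau> D 1 (id_series $ i) (2 * \<tau>)"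
      by (rule majorized_mono[OF majorized_id]) (use \<tau> in auto)
    then show ?case by (simp add: G_def)
  next
    case (Suc n)
    have "majorized lam M \<tau> D 1 (lin_step lam f (G n) $ i) (2 * \<tau>)"
      by (rule majorized_lin_step[OF nonres f fle A B _ small small2 Suc]) (use \<tau> in auto)
    then show ?case by (simp add: G_def)
  qed
  have close: "close_upto n 1 (H $ i) (G n $ i)" for n i
  proof (induction n arbitrary: i)
    case 0
    show ?case using ord_ge_lin_step[of lam f H i]
      by (auto simp: G_def H[symmetric] close_upto_def ord_ge_def mcoeff_id_series)
  next
    case (Suc n)
    then show ?case using lin_step_close_upto[OF f, of n H "G n" lam i] by (simp add: H[symmetric] G_def)
  qed
  have "cmod (mcoeff (H $ i) \<alpha>) \<le> 2 * \<tau> * (1 / \<tau>) ^ mdeg \<alpha> * max_weight lam M 1 \<alpha>" for i \<alpha>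
  proof -
    have eq: "mcoeff (H $ i) \<alpha> = mcoeff (G (mdeg \<alpha>) $ i) \<alpha>"
      using close[of "mdeg \<alpha>" i] by (auto simp: close_upto_def ord_ge_def)
    obtain s where s: "\<And>\<beta>. 0 \<le> s \<beta>" "cmod (mcoeff (G (mdeg \<alpha>) $ i) \<alpha>) \<le> s \<alpha> * max_weight lam M 1 \<alpha>"
      "(\<Sum>\<beta> | mdeg \<beta> \<le> mdeg \<alpha>. s \<beta> * \<tau> ^ mdeg \<beta>) \<le> 2 * \<tau>"
      using maj[of "mdeg \<alpha>" "mdeg \<alpha>" i] by (auto simp: majorized_def)
    have "s \<alpha> * \<tau> ^ mdeg \<alpha> \<le> (\<Sum>\<beta> | mdeg \<beta> \<le> mdeg \<alpha>. s \<beta> * \<tau> ^ mdeg \<beta>)"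
      using \<tau> s(1) by (intro member_le_sum) auto
    then have "s \<alpha> * \<tau> ^ mdeg \<alpha> \<le> 2 * \<tau>" using s(3) by linarith
    then have "s \<alpha> \<le> 2 * \<tau> * (1 / \<tau>) ^ mdeg \<alpha>" using \<tau> by (simp add: field_simps)
    then show ?thesis
      unfolding eq using mult_right_mono[OF _ max_weight_nonneg, of "s \<alpha>"] s(2) by (blast intro: order_trans)
  qed
  then show ?thesis using that[of "2 * \<tau>" "1 / \<tau>"] \<tau> by simp
qed

section \<open>Series classes and levels\<close>

lemma mcoeff_linear_series_mdeg_ge_2:
  assumes "2 \<le> mdeg \<alpha>"
  shows "mcoeff (linear_series A $ i) \<alpha> = 0"
proof -
  have "\<alpha> \<noteq> axis j 1" for j using assms by auto
  then show ?thesis by (simp add: mcoeff_linear_series)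
qed

lemma norm_vcoeff_le: 
  fixes c :: real
  assumes "\<And>i. cmod (mcoeff (H $ i) \<alpha>) \<le> c"
  shows "norm (vcoeff (H :: 'n::finite vfps) \<alpha>) \<le> real CARD('n) * c"
proof -
  have "norm (vcoeff H \<alpha>) \<le> (\<Sum>i\<in>UNIV. norm (vcoeff H \<alpha> $ i))"
    unfolding norm_vec_def by (rule L2_set_le_sum) simp
  also have "\<dots> \<le> (\<Sum>i\<in>(UNIV :: 'n set). c)" by (intro sum_mono) (simp add: vcoeff_def assms)
  finally show ?thesis by simp
qed

lemma norm_mcoeff_le_vcoeff: "cmod (mcoeff (H $ i) \<alpha>) \<le> norm (vcoeff H \<alpha>)"
  using Finite_Cartesian_Product.norm_nth_le[of "vcoeff H \<alpha>" i] by (simp add: vcoeff_def)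

text \<open>
  The finitely many coefficients of low degree are absorbed into the constant.
\<close>

lemma series_class_if_eventually_bounded:
  fixes H :: "'n::finite vfps"
  assumes N: "\<And>k. k \<ge> 1 \<Longrightarrow> N k > 0" and A: "0 < A" and B: "0 < B"
    and le: "\<And>\<alpha>. K \<le> mdeg \<alpha> \<Longrightarrow> 1 \<le> mdeg \<alpha> \<Longrightarrow> norm (vcoeff H \<alpha>) \<le> A * B ^ mdeg \<alpha> * N (mdeg \<alpha>)"
  shows "H \<in> series_class N"
proof -
  let ?q = "\<lambda>\<alpha>. norm (vcoeff H \<alpha>) / (B ^ mdeg \<alpha> * \<bar>N (mdeg \<alpha>)\<bar>)"
  define A' where "A' = A + (\<Sum>\<alpha> | mdeg \<alpha> \<le> K. ?q \<alpha>)"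
  have q: "0 \<le> ?q \<alpha>" for \<alpha> using B by simp
  have A': "A \<le> A'" unfolding A'_def using sum_nonneg[OF q] by simp
  have "norm (vcoeff H \<alpha>) \<le> A' * B ^ mdeg \<alpha> * N (mdeg \<alpha>)" if d: "1 \<le> mdeg \<alpha>" for \<alpha>
  proof (cases "K \<le> mdeg \<alpha>")
    case True
    have "A * B ^ mdeg \<alpha> * N (mdeg \<alpha>) \<le> A' * B ^ mdeg \<alpha> * N (mdeg \<alpha>)"
      using A' B N[OF d] by (intro mult_right_mono) auto
    then show ?thesis using le[OF True d] by linarith
  next
    case False
    have "?q \<alpha> \<le> (\<Sum>\<alpha> | mdeg \<alpha> \<le> K. ?q \<alpha>)"
      using False q by (intro member_le_sum) auto
    then have "?q \<alpha> \<le> A'" unfolding A'_def using A by linarith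
    then show ?thesis using B N[OF d] by (simp add: field_simps)
  qed
  moreover have "A' > 0" using A A' by linarith
  ultimately show ?thesis unfolding series_class_def using B by blast
qed

text \<open>
  Convergence at one point with equal positive coordinates \<open>\<rho>\<close> bounds \<open>\<rho>\<^bsup>|\<alpha>|\<^esup> F\<^sub>\<alpha>\<close>.  Thus an analytic germ
  lies in the class of the constant sequence 1, which satisfies \<open>M\<^sub>k M\<^sub>l \<le> M\<^bsub>k+l-1\<^esub>\<close>.
\<close>

lemma analytic_germ_series_class:
  assumes "analytic_diffeo_germ F"
  shows "F \<in> series_class (\<lambda>_. 1)"
proof -
  obtain f where "taylor_at_0 F f" using assms by (auto simp: analytic_diffeo_germ_def)
  then obtain r where r: "r > 0" "\<And>z. dist z 0 < r \<Longrightarrow> ((\<lambda>\<alpha>. mpow z \<alpha> *s vcoeff F \<alpha>) has_sum f z) UNIV"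
    unfolding taylor_at_0_def eventually_nhds_metric by auto
  define \<rho> where "\<rho> = r / (2 * CARD('a))"
  have \<rho>: "\<rho> > 0" using r by (simp add: \<rho>_def)
  define z :: "complex ^ 'a" where "z = (\<chi> i. of_real \<rho>)"
  have "norm z \<le> (\<Sum>i\<in>UNIV. norm (z $ i))"
    unfolding norm_vec_def by (rule L2_set_le_sum) simp
  also have "\<dots> = CARD('a) * \<rho>" using \<rho> by (simp add: z_def)
  also have "\<dots> = r / 2" by (simp add: \<rho>_def)
  finally have "dist z 0 < r" using r by simp
  then have sum: "(\<lambda>\<alpha>. mpow z \<alpha> *s vcoeff F \<alpha>) summable_on UNIV"
    using r(2) by (auto simp: summable_on_def)
  have mz: "mpow z \<alpha> = of_real (\<rho> ^ mdeg \<alpha>)" for \<alpha>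
    by (simp add: mpow_def z_def mdeg_def power_sum)
  have "\<exists>C. \<forall>\<alpha>. cmod (mpow z \<alpha> * mcoeff (F $ i) \<alpha>) \<le> C" for i
  proof -
    have "bounded_linear (\<lambda>v :: complex ^ 'a. v $ i)" by (rule bounded_linear_vec_nth)
    from summable_on_bounded_linear[OF this sum]
    have "(\<lambda>\<alpha>. mpow z \<alpha> * mcoeff (F $ i) \<alpha>) summable_on UNIV"
      by (simp add: vcoeff_def o_def)
    then have "(\<lambda>\<alpha>. cmod (mpow z \<alpha> * mcoeff (F $ i) \<alpha>)) summable_on UNIV"
      by (rule summable_on_iff_abs_summable_on_complex[THEN iffD1])
    then have "cmod (mpow z \<alpha> * mcoeff (F $ i) \<alpha>) \<le> (\<Sum>\<^sub>\<infinity>\<alpha>. cmod (mpow z \<alpha> * mcoeff (F $ i) \<alpha>))" for \<alpha>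
      using finite_sum_le_infsum[of "\<lambda>\<alpha>. cmod (mpow z \<alpha> * mcoeff (F $ i) \<alpha>)" UNIV "{\<alpha>}"] by simp
    then show ?thesis by blast
  qed
  then obtain C where C: "\<And>i \<alpha>. cmod (mpow z \<alpha> * mcoeff (F $ i) \<alpha>) \<le> C i" by metis
  define D where "D = 1 + (\<Sum>i\<in>UNIV. \<bar>C i\<bar>)"
  have D: "D > 0" unfolding D_def by (simp add: add_pos_nonneg sum_nonneg)
  have "norm (vcoeff F \<alpha>) \<le> CARD('a) * (D * (1 / \<rho>) ^ mdeg \<alpha>)" for \<alpha>
  proof (rule norm_vcoeff_le)
    fix i
    have "C i \<le> (\<Sum>i\<in>UNIV. \<bar>C i\<bar>)" using member_le_sum[of i UNIV "\<lambda>i. \<bar>C i\<bar>"] by simp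
    then have "\<rho> ^ mdeg \<alpha> * cmod (mcoeff (F $ i) \<alpha>) \<le> D"
      using C[of \<alpha> i] \<rho> by (simp add: norm_mult norm_power mz D_def)
    then show "cmod (mcoeff (F $ i) \<alpha>) \<le> D * (1 / \<rho>) ^ mdeg \<alpha>"
      using \<rho> by (simp add: field_simps)
  qed
  then have "\<forall>\<alpha>. 1 \<le> mdeg \<alpha> \<longrightarrow> norm (vcoeff F \<alpha>) \<le> (CARD('a) * D) * (1 / \<rho>) ^ mdeg \<alpha> * 1"
    by (simp add: mult.assoc)
  moreover have "0 < CARD('a) * D" "0 < 1 / \<rho>" using D \<rho> by auto
  ultimately show ?thesis unfolding series_class_def by blast
qed

lemma increasing_pos_ge_1: "increasing_pos p \<Longrightarrow> 1 \<le> p v"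
  unfolding increasing_pos_def by (meson le0 order_trans strict_mono_less_eq)

lemma kappa_less:
  assumes "strict_mono p" "p 0 \<le> mdeg \<alpha>"
  shows "mdeg \<alpha> < p (Suc (kappa p \<alpha>))"
proof -
  have ex: "\<exists>j. mdeg \<alpha> < p j"
    using strict_mono_imp_increasing[OF assms(1), of "Suc (mdeg \<alpha>)"] by (auto simp: Suc_le_eq)
  define j where "j = (LEAST j. mdeg \<alpha> < p j)"
  have j: "mdeg \<alpha> < p j" unfolding j_def by (rule LeastI_ex[OF ex])
  then obtain k where k: "j = Suc k" using assms(2) by (cases j) auto
  have pk: "p k \<le> mdeg \<alpha>" using not_less_Least[of k "\<lambda>j. mdeg \<alpha> < p j"] by (simp add: j_def[symmetric] k)
  have "kappa p \<alpha> = k"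
    unfolding kappa_def
  proof (rule the_equality)
    fix l assume l: "p l \<le> mdeg \<alpha> \<and> mdeg \<alpha> < p (l + 1)"
    have "p l < p (Suc k)" "p k < p (Suc l)" using l j pk by (auto simp: k)
    then show "l = k" using strict_mono_less[OF assms(1)] by fastforce
  qed (use j k pk in auto)
  then show ?thesis using j k by simp
qed

section \<open>Divisors on the unit torus\<close>

lemma finite_zdeg_le: "finite {\<nu> :: int ^ 'n::finite. zdeg \<nu> \<le> d}"
proof -
  have "finite (vec_nth ` {\<nu> :: int ^ 'n. zdeg \<nu> \<le> d})"
  proof (rule finite_subset)
    have "\<bar>\<nu> $ i\<bar> \<le> int d" if "zdeg \<nu> \<le> d" for \<nu> :: "int ^ 'n" and i
      using that member_le_sum[of i UNIV "\<lambda>i. nat \<bar>\<nu> $ i\<bar>"] by (simp add: zdeg_def)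
    then show "vec_nth ` {\<nu> :: int ^ 'n. zdeg \<nu> \<le> d} \<subseteq> (\<Pi>\<^sub>E i\<in>UNIV. {- int d..int d})"
      by (force simp: abs_le_iff)
    show "finite (\<Pi>\<^sub>E i\<in>(UNIV::'n set). {- int d..int d})" by (intro finite_PiE) auto
  qed
  moreover have "inj_on vec_nth {\<nu> :: int ^ 'n. zdeg \<nu> \<le> d}"
    by (auto simp: inj_on_def vec_nth_inject)
  ultimately show ?thesis using finite_imageD by blast
qed

lemma zdeg_0 [simp]: "zdeg 0 = 0" by (simp add: zdeg_def)

lemma zdeg_axis: "zdeg (axis j k) = nat \<bar>k\<bar>"
  by (simp add: zdeg_def axis_def if_distrib cong: if_cong)

lemma zdeg_eq_0_iff: "zdeg \<nu> = 0 \<longleftrightarrow> \<nu> = 0"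
  by (simp add: zdeg_def vec_eq_iff)

lemma zdeg_triangle: "zdeg (\<mu> - \<nu>) \<le> zdeg \<mu> + zdeg \<nu>"
  unfolding zdeg_def sum.distrib[symmetric] by (intro sum_mono) simp

lemma Omega_tilde_le:
  assumes "zdeg \<nu> < p" "\<nu> \<noteq> axis j 1"
  shows "Omega_tilde lam p \<le> cmod (zpow lam \<nu> - lam $ j)"
proof -
  have "Omega_tilde lam p \<le> (INF \<nu>\<in>{\<nu>. zdeg \<nu> < p \<and> \<nu> \<noteq> axis j 1}. cmod (zpow lam \<nu> - lam $ j))"
    unfolding Omega_tilde_def by (rule Min_le) auto
  also have "\<dots> \<le> cmod (zpow lam \<nu> - lam $ j)"
    using assms by (intro cINF_lower bdd_belowI[of _ 0]) auto
  finally show ?thesis .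
qed

lemma Omega_tilde_antimono:
  assumes "1 \<le> p" "p \<le> q"
  shows "Omega_tilde lam q \<le> Omega_tilde lam p"
proof -
  have "Omega_tilde lam p \<in> range (\<lambda>j. INF \<nu>\<in>{\<nu>. zdeg \<nu> < p \<and> \<nu> \<noteq> axis j 1}. cmod (zpow lam \<nu> - lam $ j))"
    unfolding Omega_tilde_def by (rule Min_in) auto
  then obtain j where j: "Omega_tilde lam p = (INF \<nu>\<in>{\<nu>. zdeg \<nu> < p \<and> \<nu> \<noteq> axis j 1}. cmod (zpow lam \<nu> - lam $ j))"
    by blast
  have "(0 :: int ^ 'a) \<noteq> axis j 1" by (auto simp: vec_eq_iff axis_def)
  then have "0 \<in> {\<nu> :: int ^ 'a. zdeg \<nu> < p \<and> \<nu> \<noteq> axis j 1}" using assms by simp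
  \<comment> \<open>The infimum of the empty set of reals is unspecified.\<close>
  then have "{\<nu> :: int ^ 'a. zdeg \<nu> < p \<and> \<nu> \<noteq> axis j 1} \<noteq> {}" by blast
  then show ?thesis unfolding j using assms
    by (intro cINF_greatest Omega_tilde_le) auto
qed

lemma Omega_tilde_le_2:
  assumes unit: "\<And>i. cmod (lam $ i) = 1" and p: "1 \<le> p"
  shows "Omega_tilde lam p \<le> 2"
proof -
  have "axis undefined 1 \<noteq> (0 :: int ^ 'a)" by (auto simp: vec_eq_iff axis_def)
  then have "Omega_tilde lam p \<le> cmod (zpow lam 0 - lam $ undefined)"
    using p by (intro Omega_tilde_le) auto
  also have "\<dots> \<le> 2" using norm_triangle_ineq4[of 1 "lam $ undefined"] by (simp add: zpow_def unit)
  finally show ?thesis .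
qed

lemma Omega_le:
  assumes "0 < zdeg \<nu>" "zdeg \<nu> \<le> p"
  shows "Omega \<omega> p \<le> dist_to_int (\<Sum>j\<in>UNIV. of_int (\<nu> $ j) * \<omega> $ j)"
  unfolding Omega_def using assms
  by (intro Min_le finite_imageI finite_subset[OF _ finite_zdeg_le[of p]]) auto

lemma Omega_antimono:
  fixes \<omega> :: "real ^ 'n::finite"
  assumes "1 \<le> p" "p \<le> q"
  shows "Omega \<omega> q \<le> Omega \<omega> p"
proof -
  have ne: "axis undefined 1 \<in> {\<nu> :: int ^ 'n. 0 < zdeg \<nu> \<and> zdeg \<nu> \<le> p}"
    using assms by (simp add: zdeg_axis)
  have fin: "finite {\<nu> :: int ^ 'n. 0 < zdeg \<nu> \<and> zdeg \<nu> \<le> d}" for d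
    by (rule finite_subset[OF _ finite_zdeg_le[of d]]) auto
  show ?thesis unfolding Omega_def
    using assms ne fin[of q] by (intro Min_antimono image_mono) auto
qed

lemma dist_to_int_le_half: "dist_to_int x \<le> 1 / 2"
  using of_int_round_abs_le[of x] by (simp add: dist_to_int_def abs_minus_commute)

text \<open>
  On \<open>[0, 1/6]\<close> the derivative of \<open>sin (\<pi> y) - y\<close> is nonnegative, and on \<open>[1/6, 1/2]\<close> one has
  \<open>sin (\<pi> y) \<ge> 1/2 \<ge> y\<close>.
\<close>

lemma abs_le_abs_sin_pi:
  assumes "\<bar>y\<bar> \<le> 1 / 2"
  shows "\<bar>y\<bar> \<le> \<bar>sin (pi * y)\<bar>"
proof -
  have pos: "y \<le> sin (pi * y)" if "0 \<le> y" "y \<le> 1 / 2" for y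
  proof (cases "y \<le> 1 / 6")
    case True
    have "sin (pi * 0) - 0 \<le> sin (pi * y) - y"
    proof (rule DERIV_nonneg_imp_nondecreasing[OF that(1)])
      fix x assume x: "0 \<le> x" "x \<le> y"
      have "cos (pi / 3) \<le> cos (pi * x)"
        using x True mult_left_mono[of x "1 / 3" pi] by (intro cos_monotone_0_pi_le) (auto intro: mult_nonneg_nonneg)
      then have "1 / 2 \<le> cos (pi * x)" by (simp add: cos_60)
      then have "pi * (1 / 2) \<le> pi * cos (pi * x)" by (intro mult_left_mono) auto
      then have "0 \<le> pi * cos (pi * x) - 1" using pi_gt3 by linarith
      moreover have "((\<lambda>x. sin (pi * x) - x) has_real_derivative pi * cos (pi * x) - 1) (at x)"
        by (auto intro!: derivative_eq_intros)
      ultimately show "\<exists>d. ((\<lambda>x. sin (pi * x) - x) has_real_derivative d) (at x) \<and> 0 \<le> d" by blast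
    qed
    then show ?thesis by simp
  next
    case False
    have "sin (pi / 6) \<le> sin (pi * y)"
      using False that mult_left_mono[of "1 / 6" y pi] mult_left_mono[of y "1 / 2" pi]
      by (intro sin_monotone_2pi_le) auto
    then show ?thesis using that by (simp add: sin_30)
  qed
  have "\<bar>y\<bar> \<le> sin (pi * \<bar>y\<bar>)" using pos[of "\<bar>y\<bar>"] assms by simp
  also have "\<dots> \<le> \<bar>sin (pi * y)\<bar>" by (cases "0 \<le> y") auto
  finally show ?thesis .
qed

lemma dist_to_int_le_chord: "2 * dist_to_int x \<le> cmod (exp (\<i> * of_real (2 * pi * x)) - 1)"
proof -
  define y where "y = x - of_int (round x)"
  have "\<bar>sin (pi * x)\<bar> = \<bar>sin (pi * y)\<bar>"
  proof -
    have "pi * x = pi * y + of_int (round x) * pi" by (simp add: y_def algebra_simps)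
    then have "sin (pi * x) = sin (pi * y) * cos (of_int (round x) * pi) + cos (pi * y) * sin (of_int (round x) * pi)"
      by (simp only: sin_add)
    also have "sin (of_int (round x) * pi) = 0" using sin_zero_iff_int2 by blast
    finally have s: "sin (pi * x) = sin (pi * y) * cos (of_int (round x) * pi)" by simp
    have "\<bar>cos (of_int (round x) * pi)\<bar> = 1"
      using sin_zero_abs_cos_one[OF \<open>sin (of_int (round x) * pi) = 0\<close>] .
    then show ?thesis by (simp add: s abs_mult)
  qed
  moreover have "\<bar>y\<bar> \<le> \<bar>sin (pi * y)\<bar>"
    using dist_to_int_le_half[of x] by (intro abs_le_abs_sin_pi) (simp add: y_def dist_to_int_def)
  ultimately have "2 * dist_to_int x \<le> 2 * \<bar>sin (pi * x)\<bar>"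
    by (simp add: dist_to_int_def y_def)
  also have "\<dots> = cmod (exp (\<i> * of_real (2 * pi * x)) - 1)"
    using dist_exp_i_1[of "2 * pi * x"] by simp
  finally show ?thesis .
qed

text \<open>
  \<open>\<lambda>\<^sup>\<gamma> - \<lambda>\<^sub>i = \<lambda>\<^sub>i (e\<^bsup>2\<pi>i x\<^esup> - 1)\<close> for \<open>x = (\<gamma> - e\<^sub>i) \<cdot> \<omega>\<close>.  Since \<open>\<gamma> - e\<^sub>i\<close> may have norm \<open>|\<gamma>| + 1\<close>, the quantity
  \<open>\<Omega>(p)\<close> only controls exponents of degree below \<open>p\<close>.  This is the range that the counting
  lemma needs at level \<open>p\<close>.
\<close>

lemma Omega_le_divisor:
  assumes unit: "\<And>i. cmod (lam $ i) = 1" and nonres: "\<not> resonant lam"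
    and \<gamma>: "2 \<le> mdeg \<gamma>" "mdeg \<gamma> < p"
  shows "2 * Omega (rotation_vector lam) p \<le> cmod (mpow lam \<gamma> - lam $ i)"
proof -
  let ?\<omega> = "rotation_vector lam"
  have l: "lam $ j = exp (\<i> * of_real (2 * pi * ?\<omega> $ j))" for j
    using rotation_vector(1)[OF unit nonres, of j] by (simp add: mult_ac)
  define \<nu> :: "int ^ 'a" where "\<nu> = (\<chi> j. int (\<gamma> $ j)) - axis i 1"
  define x where "x = (\<Sum>j\<in>UNIV. of_int (\<nu> $ j) * ?\<omega> $ j)"
  have zg: "zdeg (\<chi> j. int (\<gamma> $ j)) = mdeg \<gamma>" by (simp add: zdeg_def mdeg_def)
  have z1: "zdeg \<nu> \<le> p"
    using zdeg_triangle[of "\<chi> j. int (\<gamma> $ j)" "axis i 1"] \<gamma> by (simp add: \<nu>_def zg zdeg_axis)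
  have z0: "0 < zdeg \<nu>"
  proof (rule ccontr)
    assume "\<not> 0 < zdeg \<nu>"
    then have "(\<chi> j. int (\<gamma> $ j)) = axis i 1" by (simp add: zdeg_eq_0_iff \<nu>_def)
    then have "mdeg \<gamma> = 1" using zg by (simp add: zdeg_axis)
    then show False using \<gamma> by simp
  qed
  have xs: "x = (\<Sum>j\<in>UNIV. real (\<gamma> $ j) * ?\<omega> $ j) - ?\<omega> $ i"
  proof -
    have "x = (\<Sum>j\<in>UNIV. real (\<gamma> $ j) * ?\<omega> $ j - (if j = i then ?\<omega> $ i else 0))"
      unfolding x_def by (rule sum.cong) (auto simp: \<nu>_def axis_def algebra_simps)
    then show ?thesis by (simp add: sum_subtractf)
  qed
  have "mpow lam \<gamma> = (\<Prod>j\<in>UNIV. exp (\<i> * of_real (2 * pi * (real (\<gamma> $ j) * ?\<omega> $ j))))"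
    unfolding mpow_def by (subst l) (simp add: exp_of_nat_mult[symmetric] mult_ac)
  also have "\<dots> = exp (\<Sum>j\<in>UNIV. \<i> * of_real (2 * pi * (real (\<gamma> $ j) * ?\<omega> $ j)))"
    by (rule exp_sum[symmetric]) simp
  also have "(\<Sum>j\<in>UNIV. \<i> * of_real (2 * pi * (real (\<gamma> $ j) * ?\<omega> $ j))) =
      \<i> * of_real (2 * pi * ?\<omega> $ i) + \<i> * of_real (2 * pi * x)"
    by (simp add: xs sum_distrib_left[symmetric] algebra_simps)
  finally have "mpow lam \<gamma> - lam $ i = lam $ i * (exp (\<i> * of_real (2 * pi * x)) - 1)"
    by (simp only: exp_add l[symmetric] right_diff_distrib mult_1_right)
  then have "cmod (mpow lam \<gamma> - lam $ i) = cmod (exp (\<i> * of_real (2 * pi * x)) - 1)"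
    by (simp only: norm_mult unit mult_1)
  then show ?thesis
    using dist_to_int_le_chord[of x] Omega_le[OF z0 z1, of ?\<omega>] by (simp add: x_def)
qed

lemma Omega_tilde_le_divisor:
  assumes \<gamma>: "2 \<le> mdeg \<gamma>" "mdeg \<gamma> < p"
  shows "Omega_tilde lam p \<le> cmod (mpow lam \<gamma> - lam $ i)"
proof -
  have zg: "zdeg (\<chi> j. int (\<gamma> $ j)) = mdeg \<gamma>" by (simp add: zdeg_def mdeg_def)
  then have "(\<chi> j. int (\<gamma> $ j)) \<noteq> axis i 1" using \<gamma> zdeg_axis[of i 1] by auto
  then have "Omega_tilde lam p \<le> cmod (zpow lam (\<chi> j. int (\<gamma> $ j)) - lam $ i)"
    using \<gamma> zg by (intro Omega_tilde_le) auto
  then show ?thesis by (simp add: zpow_def mpow_def)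
qed

text \<open>
  By compactness of the disc two powers of \<open>z\<close> are close; dividing by the lower one and multiplying
  by \<open>z\<close> gives a power close to \<open>z\<close> itself.
\<close>

lemma unit_power_recurrence:
  fixes z :: complex
  assumes "cmod z = 1"
  obtains m where "2 \<le> m" "cmod (z ^ m - z) < 1 / 2"
proof -
  have "\<forall>n. z ^ n \<in> cball 0 1" using assms by (simp add: norm_power)
  then obtain l r where "strict_mono (r :: nat \<Rightarrow> nat)" "((\<lambda>n. z ^ n) \<circ> r) \<longlonglongrightarrow> l"
    using compact_cball[of "0 :: complex" 1] unfolding compact_def by metis
  note r = this
  then have "Cauchy ((\<lambda>n. z ^ n) \<circ> r)" using LIMSEQ_imp_Cauchy by blast
  then obtain n where "\<And>k l. n \<le> k \<Longrightarrow> n \<le> l \<Longrightarrow> dist (z ^ r k) (z ^ r l) < 1 / 2"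
    unfolding Cauchy_def by (metis comp_apply half_gt_zero zero_less_one)
  then have n: "dist (z ^ r (Suc n)) (z ^ r n) < 1 / 2" by simp
  have less: "r n < r (Suc n)" using r(1) by (simp add: strict_mono_Suc_iff)
  define m where "m = Suc (r (Suc n) - r n)"
  have "z ^ r n * (z ^ m - z) = z * (z ^ r (Suc n) - z ^ r n)"
    using less by (simp add: m_def algebra_simps flip: power_add)
  then have "cmod (z ^ m - z) = cmod (z ^ r (Suc n) - z ^ r n)"
    using assms by (metis norm_mult norm_power power_one mult_1)
  then show ?thesis using that[of m] n less by (simp add: dist_norm m_def)
qed

lemma Omega_tilde_eventually_le_half:
  assumes unit: "\<And>i. cmod (lam $ i) = 1"
  obtains m where "\<And>p. m < p \<Longrightarrow> Omega_tilde lam p \<le> 1 / 2"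
proof -
  fix i :: 'a
  obtain m where m: "2 \<le> m" "cmod ((lam $ i) ^ m - lam $ i) < 1 / 2"
    using unit_power_recurrence[OF unit[of i]] by blast
  have "Omega_tilde lam p \<le> 1 / 2" if "m < p" for p
    using Omega_tilde_le_divisor[of "axis i m" p lam i] m that by (simp add: mpow_axis_power)
  then show ?thesis using that by blast
qed

section \<open>Growth of the linearization\<close>

lemma linearization_eq_lin_step:
  assumes "\<not> resonant lam" "f \<in> V 1" "F = linear_series (diag_matrix lam) + f"
    and "H = linearization (diag_matrix lam) F"
  shows "H = lin_step lam f H"
proof -
  have "linearizes (diag_matrix lam) F H"
    unfolding assms(3,4) linearization_def by (rule theI'[OF linearization_ex1[OF assms(1,2)]])
  then show ?thesis
    unfolding assms(3) linearizes_iff_fixed[OF assms(1,2)] .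
qed

lemma single_tree_weight_le:
  assumes pos: "\<And>k. k \<ge> 1 \<Longrightarrow> M k > 0"
    and mult: "\<And>k l. k \<ge> 1 \<Longrightarrow> l \<ge> 1 \<Longrightarrow> M k * M l \<le> M (k + l - 1)"
    and \<alpha>: "1 \<le> mdeg \<alpha>" and E: "0 \<le> E" "\<And>t. idx t = \<alpha> \<Longrightarrow> inv_divisors lam t \<le> E"
  shows "max_weight lam M 1 \<alpha> \<le> E * (M (mdeg \<alpha>) / M 1)"
proof -
  have M1: "M 1 > 0" using pos by simp
  have Md: "M (mdeg \<alpha>) > 0" using pos \<alpha> by simp
  show ?thesis
  proof (rule max_weight_cases[of 1 lam M \<alpha>])
    fix t assume t: "arity t = 1" "idx t = \<alpha>" "max_weight lam M 1 \<alpha> = forest_weight lam M t"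
    have "M 1 * arity_weight M t \<le> M (mdeg \<alpha>)"
      using arity_weight_le[of M t 0, OF pos mult] t by simp
    then have "arity_weight M t \<le> M (mdeg \<alpha>) / M 1" using M1 by (simp add: field_simps)
    then show ?thesis
      unfolding t(3) forest_weight_def using E t(2) arity_weight_pos[of M t, OF pos]
      by (intro mult_mono) auto
  qed (use E M1 Md in auto)
qed

text \<open>
  The common core of all three cases: up to a geometric factor the coefficients of \<open>H\<close> grow at most
  like \<open>M\<close> times the level bound for the products of inverse divisors along trees.
\<close>

lemma linearization_growth:
  fixes f H :: "'n::finite vfps" and p :: "nat \<Rightarrow> nat"
  assumes unit: "\<And>i. cmod (lam $ i) = 1" and nonres: "\<not> resonant lam"
    and pos: "\<And>k. k \<ge> 1 \<Longrightarrow> M k > 0"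
    and mult: "\<And>k l. k \<ge> 1 \<Longrightarrow> l \<ge> 1 \<Longrightarrow> M k * M l \<le> M (k + l - 1)"
    and f: "f \<in> V 1" and F: "F = linear_series (diag_matrix lam) + f" "F \<in> series_class M"
    and H: "H = linearization (diag_matrix lam) F"
    and T: "\<And>v. 0 < T v" "\<And>v. T v \<le> 1" and p: "\<And>v. 1 \<le> p v"
    and low: "\<And>v \<gamma> i. 2 \<le> mdeg \<gamma> \<Longrightarrow> mdeg \<gamma> < p v \<Longrightarrow> 2 * T v \<le> cmod (mpow lam \<gamma> - lam $ i)"
  obtains A B where "0 < A" "0 < B"
    "\<And>\<alpha> K. 1 \<le> mdeg \<alpha> \<Longrightarrow> mdeg \<alpha> < p (Suc K) \<Longrightarrow> norm (vcoeff H \<alpha>) \<le>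
       A * B ^ mdeg \<alpha> * M (mdeg \<alpha>) * exp (mdeg \<alpha> * (2 * (\<Sum>v\<le>K. ln (1 / T (Suc v)) / p v)))"
proof -
  have fixed: "H = lin_step lam f H"
    by (rule linearization_eq_lin_step[OF nonres f F(1) H])
  obtain A0 B0 where AB0: "0 < A0" "0 < B0"
    "\<And>\<alpha>. 1 \<le> mdeg \<alpha> \<Longrightarrow> norm (vcoeff F \<alpha>) \<le> A0 * B0 ^ mdeg \<alpha> * M (mdeg \<alpha>)"
    using F(2) unfolding series_class_def by blast
  have fle: "cmod (mcoeff (f $ i) \<alpha>) \<le> A0 * B0 ^ mdeg \<alpha> * M (mdeg \<alpha>)" if "2 \<le> mdeg \<alpha>" for i \<alpha>
    using norm_mcoeff_le_vcoeff[of F i \<alpha>] AB0(3)[of \<alpha>] that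
      mcoeff_linear_series_mdeg_ge_2[OF that, of "diag_matrix lam" i] by (simp add: F(1))
  obtain A1 B1 where AB1: "0 < A1" "0 < B1"
    "\<And>i \<alpha>. cmod (mcoeff (H $ i) \<alpha>) \<le> A1 * B1 ^ mdeg \<alpha> * max_weight lam M 1 \<alpha>"
    using linearization_majorized[OF nonres f fixed fle] AB0 by (metis less_imp_le)
  define A where "A = CARD('n) * A1 / M 1"
  define B where "B = B1 / T 0"
  have M1: "M 1 > 0" using pos by simp
  have AB: "0 < A" "0 < B" using AB1 M1 T(1)[of 0] by (auto simp: A_def B_def)
  have "norm (vcoeff H \<alpha>) \<le>
      A * B ^ mdeg \<alpha> * M (mdeg \<alpha>) * exp (mdeg \<alpha> * (2 * (\<Sum>v\<le>K. ln (1 / T (Suc v)) / p v)))"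
    if \<alpha>: "1 \<le> mdeg \<alpha>" "mdeg \<alpha> < p (Suc K)" for \<alpha> K
  proof -
    define d where "d = mdeg \<alpha>"
    define \<Sigma> where "\<Sigma> = 2 * (\<Sum>v\<le>K. ln (1 / T (Suc v)) / p v)"
    define E where "E = exp (d * (ln (1 / T 0) + \<Sigma>))"
    have "inv_divisors lam t \<le> E" if "idx t = \<alpha>" for t
      using inv_divisors_le(2)[of lam T p t K, OF unit T p low] that \<alpha>(2)
      by (simp add: E_def d_def \<Sigma>_def)
    then have w: "max_weight lam M 1 \<alpha> \<le> E * (M d / M 1)"
      unfolding d_def by (intro single_tree_weight_le pos mult \<alpha>) (auto simp: E_def)
    have E: "E = (1 / T 0) ^ d * exp (d * \<Sigma>)"
      using T(1)[of 0] by (simp add: E_def distrib_left exp_add exp_of_nat_mult)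
    have "norm (vcoeff H \<alpha>) \<le> CARD('n) * (A1 * B1 ^ d * (E * (M d / M 1)))"
    proof (rule norm_vcoeff_le)
      fix i
      have "A1 * B1 ^ d * max_weight lam M 1 \<alpha> \<le> A1 * B1 ^ d * (E * (M d / M 1))"
        using AB1 by (intro mult_left_mono w) auto
      then show "cmod (mcoeff (H $ i) \<alpha>) \<le> A1 * B1 ^ d * (E * (M d / M 1))"
        using AB1(3)[of i \<alpha>] by (simp add: d_def)
    qed
    also have "\<dots> = A * B ^ d * M d * exp (d * \<Sigma>)"
      by (simp add: A_def B_def E power_divide mult_ac)
    finally show ?thesis by (simp add: d_def \<Sigma>_def)
  qed
  with AB that show ?thesis by blast
qed

text \<open>
  The levels used for the Bruno condition are \<open>Omega_tilde lam (p v) / 2\<close>, and the extra \<open>ln 2\<close> has to be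
  paid in every term.  This is possible because powers of \<open>\<lambda>\<^sub>i\<close> return close to \<open>\<lambda>\<^sub>i\<close>: eventually
  \<open>Omega_tilde lam (p v)\<close> is at most \<open>1/2\<close>, so that \<open>ln 2 / p v\<close> is dominated by a term of the convergent
  series.
\<close>

lemma bruno_condition_bounded_sum:
  assumes unit: "\<And>i. cmod (lam $ i) = 1" and bruno: "bruno_condition lam"
  obtains p C where "increasing_pos p" "\<And>v. 0 < Omega_tilde lam (p v)"
    "\<And>K. (\<Sum>v\<le>K. ln (1 / (Omega_tilde lam (p (Suc v)) / 2)) / p v) \<le> C"
proof -
  let ?O = "Omega_tilde lam"
  obtain p where p: "increasing_pos p" "\<And>k. 0 < ?O (p (k + 1))"
    and sum: "summable (\<lambda>k. ln (inverse (?O (p (k + 1)))) / real (p k))"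
    using bruno unfolding bruno_condition_def by blast
  have mono: "strict_mono p" and p0: "1 \<le> p 0" using p(1) by (auto simp: increasing_pos_def)
  note p1 = increasing_pos_ge_1[OF p(1)]
  have Opos: "0 < ?O (p v)" for v
  proof (cases v)
    case 0
    have "?O (p 1) \<le> ?O (p 0)"
      by (rule Omega_tilde_antimono[OF p0]) (use strict_mono_less_eq[OF mono, of 0 1] in simp)
    then show ?thesis using p(2)[of 0] 0 by simp
  next
    case (Suc k)
    then show ?thesis using p(2)[of k] by simp
  qed
  obtain m where m: "\<And>q. m < q \<Longrightarrow> ?O q \<le> 1 / 2"
    using Omega_tilde_eventually_le_half[OF unit] by blast
  have "norm (ln 2 / real (p k)) \<le> ln (inverse (?O (p (k + 1)))) / real (p k)" if "m \<le> k" for k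
  proof -
    have "m < p (k + 1)" using strict_mono_imp_increasing[OF mono, of "k + 1"] that by linarith
    then have "ln 2 \<le> ln (inverse (?O (p (k + 1))))"
      using m[of "p (k + 1)"] Opos[of "k + 1"] by (subst ln_le_cancel_iff) (auto simp: field_simps)
    then show ?thesis using p1[of k] by (simp add: divide_right_mono)
  qed
  then have "summable (\<lambda>k. ln 2 / real (p k))" by (rule summable_comparison_test'[OF sum])
  from summable_add[OF sum this]
  have "summable (\<lambda>k. (ln (inverse (?O (p (Suc k)))) + ln 2) / p k)"
    by (simp add: add_divide_distrib)
  moreover have "ln (inverse (?O (p (Suc k)))) + ln 2 = ln (1 / (?O (p (Suc k)) / 2))" for k
    using Opos[of "Suc k"] by (simp add: ln_div ln_inverse)
  ultimately have "summable (\<lambda>k. ln (1 / (?O (p (Suc k)) / 2)) / p k)" (is "summable ?a") by simp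
  moreover have a0: "0 \<le> ?a k" for k
    using Opos[of "Suc k"] p1[of k] Omega_tilde_le_2[OF unit p1[of "Suc k"]]
    by (intro divide_nonneg_nonneg ln_ge_zero) (auto simp: field_simps)
  ultimately have "(\<Sum>v\<le>K. ?a v) \<le> suminf ?a" for K by (intro sum_le_suminf) auto
  with p(1) Opos that show ?thesis by blast
qed

lemma linearization_class_of_bruno:
  fixes f H :: "'n::finite vfps"
  assumes unit: "\<And>i. cmod (lam $ i) = 1" and nonres: "\<not> resonant lam"
    and pos: "\<And>k. k \<ge> 1 \<Longrightarrow> M k > 0"
    and mult: "\<And>k l. k \<ge> 1 \<Longrightarrow> l \<ge> 1 \<Longrightarrow> M k * M l \<le> M (k + l - 1)"
    and f: "f \<in> V 1" and F: "F = linear_series (diag_matrix lam) + f" "F \<in> series_class M"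
    and H: "H = linearization (diag_matrix lam) F"
    and bruno: "bruno_condition lam"
  shows "H \<in> series_class M"
proof -
  let ?O = "Omega_tilde lam"
  obtain p C where p: "increasing_pos p" and O: "\<And>v. 0 < ?O (p v)"
    and C: "\<And>K. (\<Sum>v\<le>K. ln (1 / (?O (p (Suc v)) / 2)) / p v) \<le> C"
    using bruno_condition_bounded_sum[OF unit bruno] by blast
  have mono: "strict_mono p" and p0: "1 \<le> p 0" using p by (auto simp: increasing_pos_def)
  note p1 = increasing_pos_ge_1[OF p]
  have le1: "?O (p v) / 2 \<le> 1" for v
    using Omega_tilde_le_2[OF unit p1[of v]] by simp
  obtain A B where AB: "0 < A" "0 < B"
    "\<And>\<alpha> K. 1 \<le> mdeg \<alpha> \<Longrightarrow> mdeg \<alpha> < p (Suc K) \<Longrightarrow> norm (vcoeff H \<alpha>) \<le>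
       A * B ^ mdeg \<alpha> * M (mdeg \<alpha>) * exp (mdeg \<alpha> * (2 * (\<Sum>v\<le>K. ln (1 / (?O (p (Suc v)) / 2)) / p v)))"
    using linearization_growth[OF unit nonres pos mult f F H, of "\<lambda>v. ?O (p v) / 2" p] O le1 p1
      Omega_tilde_le_divisor[of _ _ lam] by auto
  show ?thesis
  proof (rule series_class_if_eventually_bounded[OF pos])
    fix \<alpha> :: "nat ^ 'n" assume \<alpha>: "p 0 \<le> mdeg \<alpha>" "1 \<le> mdeg \<alpha>"
    let ?d = "mdeg \<alpha>"
    have "norm (vcoeff H \<alpha>) \<le> A * B ^ ?d * M ?d * exp (?d * (2 * (\<Sum>v\<le>kappa p \<alpha>. ln (1 / (?O (p (Suc v)) / 2)) / p v)))"
      by (rule AB(3)[OF \<alpha>(2) kappa_less[OF mono \<alpha>(1)]])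
    also have "\<dots> \<le> A * B ^ ?d * M ?d * exp (?d * (2 * C))"
      using AB C[of "kappa p \<alpha>"] pos[OF \<alpha>(2)] by (intro mult_left_mono iffD2[OF exp_le_cancel_iff]) auto
    also have "\<dots> = A * (B * exp (2 * C)) ^ ?d * M ?d"
      by (simp add: exp_of_nat_mult power_mult_distrib)
    finally show "norm (vcoeff H \<alpha>) \<le> A * (B * exp (2 * C)) ^ ?d * M ?d" .
  qed (use AB in auto)
qed

text \<open>
  Here the levels are \<open>\<Omega>(p v)\<close> themselves.  An additional constant as for the Bruno condition would
  not be harmless, since \<open>\<Sum> 1 / p v\<close> may diverge; the chord estimate \<open>|e\<^bsup>2\<pi>i x\<^esup> - 1| \<ge> 2 {x}\<close>
  provides the factor 2 needed for the levels.
\<close>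

lemma linearization_class_of_limsup:
  fixes f H :: "'n::finite vfps"
  assumes unit: "\<And>i. cmod (lam $ i) = 1" and nonres: "\<not> resonant lam"
    and pos: "\<And>k. k \<ge> 1 \<Longrightarrow> M k > 0"
    and mult: "\<And>k l. k \<ge> 1 \<Longrightarrow> l \<ge> 1 \<Longrightarrow> M k * M l \<le> M (k + l - 1)"
    and f: "f \<in> V 1" and F: "F = linear_series (diag_matrix lam) + f" "F \<in> series_class M"
    and H: "H = linearization (diag_matrix lam) F"
    and posN: "\<And>k. k \<ge> 1 \<Longrightarrow> N k > 0"
    and limsup: "limsup_condition lam (\<lambda>k. N k / M k)"
  shows "H \<in> series_class N"
proof -
  let ?O = "Omega (rotation_vector lam)"
  obtain p where p: "increasing_pos p" and O': "\<And>m. 0 < ?O (p (m + 1))"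
    and L: "Limsup (filtercomap mdeg at_top) (\<lambda>\<alpha> :: nat ^ 'n. ereal
       (2 * (\<Sum>m\<le>kappa p \<alpha>. ln (inverse (?O (p (m + 1)))) / real (p m))
         - 1 / real (mdeg \<alpha>) * ln (N (mdeg \<alpha>) / M (mdeg \<alpha>)))) < \<infinity>"
    using limsup unfolding limsup_condition_def by blast
  have mono: "strict_mono p" and p0: "1 \<le> p 0" using p by (auto simp: increasing_pos_def)
  note p1 = increasing_pos_ge_1[OF p]
  have O: "0 < ?O (p v)" for v
  proof (cases v)
    case 0
    have "?O (p 1) \<le> ?O (p 0)"
      by (rule Omega_antimono[OF p0]) (use strict_mono_less_eq[OF mono, of 0 1] in simp)
    then show ?thesis using O'[of 0] 0 by simp
  next
    case (Suc k)
    then show ?thesis using O'[of k] by simp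
  qed
  have le1: "?O (p v) \<le> 1" for v
  proof -
    have "?O (p v) \<le> dist_to_int (\<Sum>j\<in>UNIV. of_int ((axis undefined 1 :: int ^ 'n) $ j) * rotation_vector lam $ j)"
      using p1[of v] by (intro Omega_le) (auto simp: zdeg_axis simp del: One_nat_def)
    then show ?thesis using dist_to_int_le_half by (smt (verit) field_sum_of_halves)
  qed
  define g :: "nat ^ 'n \<Rightarrow> real" where "g \<alpha> = 2 * (\<Sum>m\<le>kappa p \<alpha>. ln (inverse (?O (p (m + 1)))) / real (p m))
      - 1 / real (mdeg \<alpha>) * ln (N (mdeg \<alpha>) / M (mdeg \<alpha>))" for \<alpha>
  have "Limsup (filtercomap mdeg at_top) (\<lambda>\<alpha>. ereal (g \<alpha>)) \<noteq> \<infinity>" using L by (simp add: g_def)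
  then obtain C :: nat where "Limsup (filtercomap mdeg at_top) (\<lambda>\<alpha>. ereal (g \<alpha>)) < ereal C"
    unfolding less_PInf_Ex_of_nat ..
  from Limsup_lessD[OF this]
  obtain D where D: "\<And>\<alpha>. D \<le> mdeg \<alpha> \<Longrightarrow> g \<alpha> < C"
    unfolding eventually_filtercomap_at_top_linorder by auto
  obtain A B where AB: "0 < A" "0 < B"
    "\<And>\<alpha> K. 1 \<le> mdeg \<alpha> \<Longrightarrow> mdeg \<alpha> < p (Suc K) \<Longrightarrow> norm (vcoeff H \<alpha>) \<le>
       A * B ^ mdeg \<alpha> * M (mdeg \<alpha>) * exp (mdeg \<alpha> * (2 * (\<Sum>v\<le>K. ln (1 / ?O (p (Suc v))) / p v)))"
    using linearization_growth[OF unit nonres pos mult f F H, of "\<lambda>v. ?O (p v)" p] O le1 p1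
      Omega_le_divisor[OF unit nonres] by auto
  show ?thesis
  proof (rule series_class_if_eventually_bounded[OF posN])
    fix \<alpha> :: "nat ^ 'n" assume \<alpha>: "max D (p 0) \<le> mdeg \<alpha>" "1 \<le> mdeg \<alpha>"
    define d where "d = mdeg \<alpha>"
    define S where "S = 2 * (\<Sum>v\<le>kappa p \<alpha>. ln (1 / ?O (p (Suc v))) / p v)"
    have d: "real d > 0" and M: "M d > 0" and N: "N d > 0"
      using \<alpha> pos[of d] posN[of d] by (auto simp: d_def)
    have "S < C + 1 / d * ln (N d / M d)" using D[of \<alpha>] \<alpha> by (simp add: g_def S_def d_def inverse_eq_divide)
    then have "d * S \<le> d * C + ln (N d / M d)" using d by (simp add: field_simps)
    then have "exp (d * S) \<le> exp (d * C) * (N d / M d)"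
      using M N by (metis exp_add exp_le_cancel_iff exp_ln divide_pos_pos)
    moreover have "norm (vcoeff H \<alpha>) \<le> A * B ^ d * M d * exp (d * S)"
      unfolding d_def S_def using \<alpha> by (intro AB(3) kappa_less[OF mono]) auto
    ultimately have "norm (vcoeff H \<alpha>) \<le> A * B ^ d * M d * (exp (d * C) * (N d / M d))"
      using AB M by (smt (verit) mult_left_mono mult_pos_pos zero_less_power)
    also have "\<dots> = A * (B * exp C) ^ d * N d"
      using M by (simp add: exp_of_nat_mult power_mult_distrib)
    finally show "norm (vcoeff H \<alpha>) \<le> A * (B * exp C) ^ mdeg \<alpha> * N (mdeg \<alpha>)" by (simp add: d_def)
  qed (use AB in auto)
qed

theorem theorem4p6:
  fixes lam :: "complex ^ 'n::finite" and M N :: "nat \<Rightarrow> real" and F f H :: "'n vfps"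
  assumes "\<forall>i j. i \<noteq> j \<longrightarrow> lam $ i \<noteq> lam $ j"
    and "\<forall>i. cmod (lam $ i) = 1"
    and "\<not> resonant lam"
    and "weight_seq M" and "weight_seq N"
    and "F \<in> V 0" and "f \<in> V 1" and "F = linear_series (diag_matrix lam) + f"
    and "H = linearization (diag_matrix lam) F"
  shows "(F \<in> series_class M \<inter> V 0 \<and> bruno_condition lam \<longrightarrow> H \<in> series_class M \<inter> V 0) \<and>
    (analytic_diffeo_germ F \<and> limsup_condition lam N \<longrightarrow> H \<in> series_class N \<inter> V 0) \<and>
    (F \<in> series_class M \<inter> V 0 \<and> eventually (\<lambda>k. N k \<ge> M k) at_top \<and>
       limsup_condition lam (\<lambda>k. N k / M k) \<longrightarrow> H \<in> series_class N \<inter> V 0)"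
proof -
  have unit: "\<And>i. cmod (lam $ i) = 1" using assms(2) by blast
  have M: "\<And>k. 1 \<le> k \<Longrightarrow> 0 < M k" "\<And>k l. 1 \<le> k \<Longrightarrow> 1 \<le> l \<Longrightarrow> M k * M l \<le> M (k + l - 1)"
    and N: "\<And>k. 1 \<le> k \<Longrightarrow> 0 < N k"
    using assms(4,5) by (auto simp: weight_seq_def)
  have V: "H \<in> V 0"
    using ord_ge_lin_step[of lam f H] linearization_eq_lin_step[OF assms(3,7-9)] by (simp add: V_iff)
  have 1: "H \<in> series_class M" if "F \<in> series_class M" "bruno_condition lam"
    by (rule linearization_class_of_bruno[OF unit assms(3) M assms(7,8) that(1) assms(9) that(2)])
  have 2: "H \<in> series_class N" if "analytic_diffeo_germ F" "limsup_condition lam N"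
    by (rule linearization_class_of_limsup[OF unit assms(3) _ _ assms(7,8)
          analytic_germ_series_class[OF that(1)] assms(9) N]) (use that(2) in auto)
  have 3: "H \<in> series_class N" if "F \<in> series_class M" "limsup_condition lam (\<lambda>k. N k / M k)"
    by (rule linearization_class_of_limsup[OF unit assms(3) M assms(7,8) that(1) assms(9) N that(2)])
  show ?thesis using V 1 2 3 by blast
qed

end
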